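(* Let $S_1=(A,B)\in\mathcal S$, let $K_\star=K_\star(S_1)$, and for $\Delta\in\mathbb R^{d_x\times d_u}$ let $S_2(\Delta)=(A',B')$ with $A'=A-\Delta K_\star$ and $B'=B+\Delta$. Let $d$ be a metric on $\mathcal S$, let $\varepsilon>0$, and let $\mathfrak M_d(\varepsilon;S_1)=\mathfrak M_d(\varepsilon;S_1,K_\star(S_1))$ be the local minimax complexity of estimating the policy gradient. Then $$\mathfrak M_d(\varepsilon;S_1)\ \ge\ \sup_{\Delta:\ d(S_1,S_2(\Delta))\le\varepsilon}\ \left\|\Delta^\top P_{K_\star,S_1}(A+BK_\star)\Gamma_{K_\star,S_1}\right\|_{\mathsf{op}}\times\left(1-\sqrt{\tfrac12\, d_{\mathsf{KL}}(S_1,S_2(\Delta))}\right).$$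
   Context: System: $x_{t+1}=Ax_t+Bu_t+w_t$, $x_0=0$, $t=0,1,\dots$, with $x_t\in\mathbb R^{d_x}$, $u_t\in\mathbb R^{d_u}$ and $w_t$ i.i.d. Gaussian with mean zero and covariance $\Sigma_W$. Write $S=(A,B)$. The noise covariance $\Sigma_W$ and the symmetric positive semidefinite cost matrices $Q,R$ are fixed. Cost: $J(K;S)=J_S(K)=\limsup_{T\to\infty}\frac1T\sum_{t=0}^{T-1}\mathbf E_{K,S}[x_t^\top Qx_t+u_t^\top Ru_t]$ under the control law $u_t=Kx_t$. A matrix is stable if its spectral radius is less than $1$; $K$ is stabilizing for $S$ if $A+BK$ is stable. $\mathcal S$ is the set of all $S$ for which a stabilizing $K$ exists. $K_\star(S)$ denotes (any element of) $\operatorname{argmin}_K J_S(K)$, taken to be stabilizing for $S$. For $K$ stabilizing for $S$: $P_{K,S}$ is the solution of $P=Q+K^\top RK+(A+BK)^\top P(A+BK)$, and $\Gamma_{K,S}=\sum_{t=0}^\infty (A+BK)^t\Sigma_W((A+BK)^t)^\top$. Data and experiment: $N$ experiments of length $T$ are run on the system with independent noise, giving the data $(x_{0,n},u_{0,n},\dots,u_{T-1,n},x_{T,n})$, $n\in[N]=\{1,\dots,N\}$. The experiment (input rule) is fixed; each $u_{t,n}$ is chosen as a function of $(x_{0,n},\dots,x_{t,n})$, the past trajectories $(x_{0,m},\dots,x_{T,m})$, $m<n$, and possibly auxiliary randomization, subject to $\sum_{n=1}^N\sum_{t=0}^{T-1}\mathbf E\,u_{t,n}^\top u_{t,n}\le\beta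 NT$, where $\beta>0$ is fixed. $\mathbf E_{S}$ is expectation when the data are generated by system $S$. Local minimax complexity: for a metric $d$ on $\mathcal S$, $$\mathfrak M_d(\varepsilon;S,K)=\inf_{\widehat{\nabla J}}\ \sup_{S'\in\mathcal S:\ d(S,S')\le\varepsilon}\mathbf E_{S'}\left\|\nabla_KJ(K;S')-\widehat{\nabla J}\right\|_{\mathsf{op}},$$ where the infimum is over all measurable functions of the data; the loss is $+\infty$ if $K$ is not stabilizing for $S'$. $\|\cdot\|_{\mathsf{op}}$ is the operator norm induced by the Euclidean norm. $d_{\mathsf{KL}}(S_1,S_2)$ is the Kullback–Leibler divergence $\int\log\frac{d\mathbf P_1}{d\mathbf P_2}\,d\mathbf P_1$, where $\mathbf P_i$ is the law of the data generated by $S_i$ under the same experiment. *)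

theory Defs
  imports "HOL-Probability.Probability"
begin

section \<open>Linear systems and stability\<close>

type_synonym ('x, 'u) system = "(real^'x^'x) \<times> (real^'u^'x)"

definition psd_matrix :: "real^'n^'n \<Rightarrow> bool" where
  "psd_matrix M \<longleftrightarrow> transpose M = M \<and> (\<forall>v. 0 \<le> v \<bullet> (M *v v))"

text \<open>The class power \<open>M ^ k\<close> is componentwise on \<^typ>\<open>real^'n^'n\<close>, hence a separate matrix power.\<close>

primrec mat_pow :: "real^'n^'n \<Rightarrow> nat \<Rightarrow> real^'n^'n" where
  "mat_pow M 0 = mat 1"
| "mat_pow M (Suc k) = M ** mat_pow M k"

definition complex_matrix :: "real^'n^'n \<Rightarrow> complex^'n^'n" where
  "complex_matrix M = (\<chi> i j. complex_of_real (M $ i $ j))"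

definition spectrum :: "complex^'n^'n \<Rightarrow> complex set" where
  "spectrum M = {c. \<exists>v. v \<noteq> 0 \<and> M *v v = c *s v}"

definition spectral_radius :: "real^'n^'n \<Rightarrow> real" where
  "spectral_radius M = Max (cmod ` spectrum (complex_matrix M))"

definition stable :: "real^'n^'n \<Rightarrow> bool" where
  "stable M \<longleftrightarrow> spectral_radius M < 1"

definition closed_loop :: "('x, 'u) system \<Rightarrow> real^'x^'u \<Rightarrow> real^'x^'x" where
  "closed_loop S K = fst S + snd S ** K"

definition stabilizing :: "('x, 'u) system \<Rightarrow> real^'x^'u \<Rightarrow> bool" where
  "stabilizing S K \<longleftrightarrow> stable (closed_loop S K)"

definition stabilizable_systems :: "('x::finite, 'u::finite) system set" where
  "stabilizable_systems = {S. \<exists>K. stabilizing S K}"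

definition perturbed_system ::
    "('x, 'u) system \<Rightarrow> real^'x^'u \<Rightarrow> real^'u^'x \<Rightarrow> ('x, 'u) system" where
  "perturbed_system S K D = (fst S - D ** K, snd S + D)"

section \<open>Noise and quadratic cost\<close>

text \<open>
  The mean-zero Gaussian law with covariance \<open>C\<close>, which may be singular, is described by its
  one-dimensional projections; a projection of variance 0 is the point mass at 0.
\<close>

definition centered_gaussian :: "real^'n^'n \<Rightarrow> (real^'n) measure \<Rightarrow> bool" where
  "centered_gaussian C W \<longleftrightarrow>
     prob_space W \<and> sets W = sets borel \<and>
     (\<forall>v. distr W borel (\<lambda>w. v \<bullet> w) =
        (if v \<bullet> (C *v v) = 0 then return borel 0
         else density lborel (normal_density 0 (sqrt (v \<bullet> (C *v v))))))"

primrec feedback_state ::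
    "('x, 'u) system \<Rightarrow> real^'x^'u \<Rightarrow> (nat \<Rightarrow> real^'x) \<Rightarrow> nat \<Rightarrow> real^'x" where
  "feedback_state S K w 0 = 0"
| "feedback_state S K w (Suc t) =
     fst S *v feedback_state S K w t + snd S *v (K *v feedback_state S K w t) + w t"

definition stage_cost ::
    "real^'x^'x \<Rightarrow> real^'u^'u \<Rightarrow> real^'x \<Rightarrow> real^'u \<Rightarrow> real" where
  "stage_cost Q R x u = x \<bullet> (Q *v x) + u \<bullet> (R *v u)"

text \<open>\<open>W\<close> is the law of a single noise vector.\<close>

definition lqr_cost ::
    "real^'x^'x \<Rightarrow> real^'u^'u \<Rightarrow> (real^'x) measure \<Rightarrow> ('x, 'u) system \<Rightarrow> real^'x^'u \<Rightarrow> ereal" where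
  "lqr_cost Q R W S K =
     limsup (\<lambda>T. ereal (1 / real T * (\<Sum>t<T.
       (\<integral>w. stage_cost Q R (feedback_state S K w t) (K *v feedback_state S K w t)
          \<partial>(\<Pi>\<^sub>M i\<in>(UNIV::nat set). W)))))"

definition optimal_gain ::
    "real^'x^'x \<Rightarrow> real^'u^'u \<Rightarrow> (real^'x) measure \<Rightarrow> ('x, 'u) system \<Rightarrow> real^'x^'u \<Rightarrow> bool" where
  "optimal_gain Q R W S K \<longleftrightarrow>
     is_arg_min (lqr_cost Q R W S) (\<lambda>_. True) K \<and> stabilizing S K"

text \<open>
  The inner product on \<^typ>\<open>real^'x^'u\<close> is the entrywise (Frobenius) one, so the gradient is the
  matrix of partial derivatives. It is only used at stabilizing \<open>K\<close>, where the cost is finite.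
\<close>

definition policy_gradient ::
    "real^'x^'x \<Rightarrow> real^'u^'u \<Rightarrow> (real^'x) measure \<Rightarrow> ('x, 'u) system \<Rightarrow> real^'x^'u \<Rightarrow> real^'x^'u" where
  "policy_gradient Q R W S K =
     (THE G. GDERIV (\<lambda>K'. real_of_ereal (lqr_cost Q R W S K')) K :> G)"

definition value_matrix ::
    "real^'x^'x \<Rightarrow> real^'u^'u \<Rightarrow> ('x, 'u) system \<Rightarrow> real^'x^'u \<Rightarrow> real^'x^'x" where
  "value_matrix Q R S K =
     (THE P. P = Q + transpose K ** R ** K + transpose (closed_loop S K) ** P ** closed_loop S K)"

definition state_covariance ::
    "real^'x^'x \<Rightarrow> ('x, 'u) system \<Rightarrow> real^'x^'u \<Rightarrow> real^'x^'x" where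
  "state_covariance C S K =
     (\<Sum>t. mat_pow (closed_loop S K) t ** C ** transpose (mat_pow (closed_loop S K) t))"

definition op_norm :: "real^'m^'n \<Rightarrow> real" where
  "op_norm M = onorm ((*v) M)"

section \<open>Experiments\<close>

text \<open>
  An index \<open>(n, t)\<close> means time \<open>t\<close> of run \<open>n\<close>. The input rule \<open>U n t h r\<close> gets
  the observed states \<open>h\<close>, indexed by \<open>past T n t\<close>, and the auxiliary randomization \<open>r\<close>,
  drawn once from \<open>Z\<close> independently of the noise. As \<open>r\<close> is shared by all inputs, rules that also
  depend on earlier randomized inputs are covered.
\<close>

type_synonym ('x, 'u, 'r) input_rule =
  "nat \<Rightarrow> nat \<Rightarrow> (nat \<times> nat \<Rightarrow> real^'x) \<Rightarrow> 'r \<Rightarrow> real^'u"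

type_synonym ('x, 'u) data = "(nat \<times> nat \<Rightarrow> real^'x) \<times> (nat \<times> nat \<Rightarrow> real^'u)"

definition past :: "nat \<Rightarrow> nat \<Rightarrow> nat \<Rightarrow> (nat \<times> nat) set" where
  "past T n t = {1..<n} \<times> {0..T} \<union> {n} \<times> {0..t}"

function run_state ::
    "nat \<Rightarrow> ('x::finite, 'u::finite, 'r) input_rule \<Rightarrow> ('x, 'u) system \<Rightarrow> 'r \<Rightarrow>
     (nat \<times> nat \<Rightarrow> real^'x) \<Rightarrow> nat \<times> nat \<Rightarrow> real^'x" where
  "run_state T U S r w (n, 0) = 0"
| "run_state T U S r w (n, Suc t) =
     fst S *v run_state T U S r w (n, t)
     + snd S *v U n t (\<lambda>p. if p \<in> past T n t then run_state T U S r w p else undefined) r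
     + w (n, t)"
  by pat_completeness auto
termination
  by (relation "inv_image (less_than <*lex*> less_than) (\<lambda>(T, U, S, r, w, p). p)")
    (auto simp: past_def)

definition run_input ::
    "nat \<Rightarrow> ('x::finite, 'u::finite, 'r) input_rule \<Rightarrow> ('x, 'u) system \<Rightarrow> 'r \<Rightarrow>
     (nat \<times> nat \<Rightarrow> real^'x) \<Rightarrow> nat \<times> nat \<Rightarrow> real^'u" where
  "run_input T U S r w = (\<lambda>(n, t). U n t (restrict (run_state T U S r w) (past T n t)) r)"

definition state_index :: "nat \<Rightarrow> nat \<Rightarrow> (nat \<times> nat) set" where
  "state_index N T = {1..N} \<times> {0..T}"

definition input_index :: "nat \<Rightarrow> nat \<Rightarrow> (nat \<times> nat) set" where
  "input_index N T = {1..N} \<times> {0..<T}"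

definition measurable_rule ::
    "nat \<Rightarrow> nat \<Rightarrow> 'r measure \<Rightarrow> ('x::finite, 'u::finite, 'r) input_rule \<Rightarrow> bool" where
  "measurable_rule N T Z U \<longleftrightarrow>
     (\<forall>(n, t) \<in> input_index N T.
        (\<lambda>(h, r). U n t h r) \<in> borel_measurable ((\<Pi>\<^sub>M p\<in>past T n t. borel) \<Otimes>\<^sub>M Z))"

definition data_space :: "nat \<Rightarrow> nat \<Rightarrow> ('x::finite, 'u::finite) data measure" where
  "data_space N T = (\<Pi>\<^sub>M p\<in>state_index N T. borel) \<Otimes>\<^sub>M (\<Pi>\<^sub>M p\<in>input_index N T. borel)"

definition data_law ::
    "nat \<Rightarrow> nat \<Rightarrow> (real^'x) measure \<Rightarrow> 'r measure \<Rightarrow> ('x::finite, 'u::finite, 'r) input_rule \<Rightarrow>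
     ('x, 'u) system \<Rightarrow> ('x, 'u) data measure" where
  "data_law N T W Z U S =
     distr (Z \<Otimes>\<^sub>M (\<Pi>\<^sub>M p\<in>input_index N T. W)) (data_space N T)
       (\<lambda>(r, w). (restrict (run_state T U S r w) (state_index N T),
                  restrict (run_input T U S r w) (input_index N T)))"

definition input_energy ::
    "nat \<Rightarrow> nat \<Rightarrow> (real^'x) measure \<Rightarrow> 'r measure \<Rightarrow> ('x::finite, 'u::finite, 'r) input_rule \<Rightarrow>
     ('x, 'u) system \<Rightarrow> ennreal" where
  "input_energy N T W Z U S =
     (\<Sum>n=1..N. \<Sum>t<T. \<integral>\<^sup>+ D. ennreal (snd D (n, t) \<bullet> snd D (n, t)) \<partial>data_law N T W Z U S)"

section \<open>Minimax complexity and divergence\<close>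

definition estimation_loss ::
    "real^'x^'x \<Rightarrow> real^'u^'u \<Rightarrow> nat \<Rightarrow> nat \<Rightarrow> (real^'x) measure \<Rightarrow> 'r measure \<Rightarrow>
     ('x::finite, 'u::finite, 'r) input_rule \<Rightarrow> real^'x^'u \<Rightarrow> (('x, 'u) data \<Rightarrow> real^'x^'u) \<Rightarrow>
     ('x, 'u) system \<Rightarrow> ennreal" where
  "estimation_loss Q R N T W Z U K g S =
     (if stabilizing S K
      then \<integral>\<^sup>+ D. ennreal (op_norm (policy_gradient Q R W S K - g D)) \<partial>data_law N T W Z U S
      else \<infinity>)"

definition local_minimax ::
    "real^'x^'x \<Rightarrow> real^'u^'u \<Rightarrow> nat \<Rightarrow> nat \<Rightarrow> (real^'x) measure \<Rightarrow> 'r measure \<Rightarrow>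
     ('x::finite, 'u::finite, 'r) input_rule \<Rightarrow>
     (('x, 'u) system \<Rightarrow> ('x, 'u) system \<Rightarrow> real) \<Rightarrow> real \<Rightarrow> ('x, 'u) system \<Rightarrow> real^'x^'u \<Rightarrow> ennreal" where
  "local_minimax Q R N T W Z U d \<epsilon> S K =
     (INF g \<in> borel_measurable (data_space N T).
        SUP S' \<in> {S' \<in> stabilizable_systems. d S S' \<le> \<epsilon>}. estimation_loss Q R N T W Z U K g S')"

text \<open>
  \<open>KL_divergence b M N\<close> integrates the log-density of \<open>N\<close> with respect to \<open>M\<close> over \<open>N\<close>.
  The negative part of that log-density is always integrable for probability measures, so
  non-integrability means divergence to \<open>\<infinity>\<close>.
\<close>

definition kl_div :: "'a measure \<Rightarrow> 'a measure \<Rightarrow> ereal" where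
  "kl_div P1 P2 =
     (if absolutely_continuous P2 P1 \<and> integrable P1 (entropy_density (exp 1) P2 P1)
      then ereal (KL_divergence (exp 1) P2 P1) else \<infinity>)"

definition system_kl ::
    "nat \<Rightarrow> nat \<Rightarrow> (real^'x) measure \<Rightarrow> 'r measure \<Rightarrow> ('x::finite, 'u::finite, 'r) input_rule \<Rightarrow>
     ('x, 'u) system \<Rightarrow> ('x, 'u) system \<Rightarrow> ereal" where
  "system_kl N T W Z U S1 S2 = kl_div (data_law N T W Z U S1) (data_law N T W Z U S2)"

definition sqrt_ereal :: "ereal \<Rightarrow> ereal" where
  "sqrt_ereal x = (if x = \<infinity> then \<infinity> else ereal (sqrt (real_of_ereal x)))"

end

theory Submission
  imports Defs "HOL-Computational_Algebra.Fundamental_Theorem_Algebra"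
begin

text \<open>
  Replacing \<open>(A, B)\<close> by \<open>(A - \<Delta> K, B + \<Delta>)\<close> leaves the closed loop \<open>A + B K\<close>
  unchanged, hence also \<open>P\<close> and \<open>\<Gamma>\<close>. As the policy gradient equals
  \<open>2 (R K + B\<^sup>T P (A + B K)) \<Gamma>\<close>, the gradients of the two systems differ by
  \<open>2 \<Delta>\<^sup>T P (A + B K) \<Gamma>\<close>, and Le Cam's two-point method with Pinsker's inequality bounds the
  larger of the two risks by half of this separation times \<open>1 - TV\<close>.
\<close>

section \<open>Powers of stable matrices\<close>

text \<open>\<open>policy_gradient\<close> is the gradient, selected by \<open>THE\<close>, of a
  \<open>limsup\<close> of expectations. Its closed form therefore requires the cost at all gains
  near \<open>K\<close>, not only at \<open>K\<close>. Stability is given as a spectral radius below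
  1, which by itself yields no rate. The bridge is a bound \<open>c * q^k\<close> on the powers of
  the closed loop, with the same \<open>c\<close> and \<open>q\<close> for all nearby matrices. This
  uniformity makes the cost finite around \<open>K\<close> and the state covariance continuous in
  the gain; an exact formula for the difference of two costs then gives the gradient without
  differentiating a series.\<close>

lemma complex_matrix_mult: "complex_matrix (M ** N) = complex_matrix M ** complex_matrix N"
  by (simp add: complex_matrix_def matrix_matrix_mult_def vec_eq_iff)

lemma complex_matrix_mat_1: "complex_matrix (mat 1) = mat 1"
  by (simp add: complex_matrix_def mat_def vec_eq_iff)

text \<open>Complex powers appear only through iterated application to a vector, since
  \<open>mat_pow\<close> is typed for real matrices. This identity leads back to the real
  powers.\<close>

lemma funpow_complex_matrix:
  fixes M :: "real^'n^'n"
  shows "((*v) (complex_matrix M) ^^ k) v = complex_matrix (mat_pow M k) *v v"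
  by (induction k) (simp_all add: complex_matrix_mat_1 complex_matrix_mult matrix_vector_mul_assoc)

lemma norm_vector_scalar_mult: "norm (c *s v) = cmod c * norm (v :: complex^'n)"
  by (simp add: norm_vec_def vector_scalar_mult_def norm_mult L2_set_right_distrib)

lemma funpow_matrix_add:
  fixes M :: "'a::semiring_1^'n^'n"
  shows "((*v) M ^^ k) (v + w) = ((*v) M ^^ k) v + ((*v) M ^^ k) w"
  by (induction k) (simp_all add: matrix_vector_right_distrib)

lemma funpow_matrix_scale:
  fixes M :: "'a::field^'n^'n"
  shows "((*v) M ^^ k) (c *s v) = c *s ((*v) M ^^ k) v"
  by (induction k) (simp_all add: vector_scalar_commute)

text \<open>The vector \<open>p(M) v\<close>: the usual module structure over the polynomials,
  written without forming the matrix \<open>p(M)\<close>.\<close>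

definition poly_act :: "complex^'n^'n \<Rightarrow> complex poly \<Rightarrow> complex^'n \<Rightarrow> complex^'n" where
  "poly_act M p v = (\<Sum>i\<le>degree p. coeff p i *s ((*v) M ^^ i) v)"

lemma poly_act_atMost:
  assumes "degree p \<le> n"
  shows "poly_act M p v = (\<Sum>i\<le>n. coeff p i *s ((*v) M ^^ i) v)"
  unfolding poly_act_def
  by (rule sum.mono_neutral_left) (use assms in \<open>auto simp: coeff_eq_0\<close>)

text \<open>The factor \<open>M - c\<close> commutes with \<open>q(M)\<close>. Applied before
  \<open>q(M)\<close>, it replaces \<open>v\<close> by \<open>M v - c v\<close>; applied after, it
  shows that \<open>q(M) v\<close> is in the kernel of \<open>M - c\<close> whenever
  \<open>p(M) v = 0\<close>. Each form serves one case of the induction on the degree.\<close>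

lemma poly_act_linear_factor:
  fixes M :: "complex^'n^'n"
  shows "poly_act M ([:-c, 1:] * q) v = poly_act M q (M *v v - c *s v)" (is ?A)
  "poly_act M ([:-c, 1:] * q) v = M *v poly_act M q v - c *s poly_act M q v" (is ?B)
proof -
  let ?n = "degree q"
  let ?z = "\<lambda>i. ((*v) M ^^ i) v"
  have deg: "degree ([:-c, 1:] * q) \<le> Suc ?n"
    using degree_mult_le[of "[:-c, 1:]" q] by simp
  have co: "coeff ([:-c, 1:] * q) i = (case i of 0 \<Rightarrow> 0 | Suc j \<Rightarrow> coeff q j) - c * coeff q i" for i
    by (simp add: mult_pCons_left coeff_pCons split: nat.splits)
  have "poly_act M ([:-c, 1:] * q) v
      = (\<Sum>i\<le>Suc ?n. (case i of 0 \<Rightarrow> 0 | Suc j \<Rightarrow> coeff q j) *s ?z i)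
        - (\<Sum>i\<le>Suc ?n. (c * coeff q i) *s ?z i)"
    by (simp only: poly_act_atMost[OF deg] co vector_sub_rdistrib sum_subtractf)
  also have "(\<Sum>i\<le>Suc ?n. (case i of 0 \<Rightarrow> 0 | Suc j \<Rightarrow> coeff q j) *s ?z i)
      = (\<Sum>i\<le>?n. coeff q i *s ?z (Suc i))"
    by (subst sum.atMost_Suc_shift) simp
  also have "(\<Sum>i\<le>Suc ?n. (c * coeff q i) *s ?z i) = (\<Sum>i\<le>?n. (c * coeff q i) *s ?z i)"
    by (simp add: coeff_eq_0)
  finally have eq: "poly_act M ([:-c, 1:] * q) v
      = (\<Sum>i\<le>?n. coeff q i *s ?z (Suc i)) - (\<Sum>i\<le>?n. (c * coeff q i) *s ?z i)" .
  have "?z (Suc i) = ((*v) M ^^ i) (M *v v)" for i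
    by (simp add: funpow_swap1)
  then have *: "((*v) M ^^ i) (M *v v - c *s v) = ?z (Suc i) - c *s ?z i" for i
    using funpow_matrix_add[where k=i and M=M and v="M *v v - c *s v" and w="c *s v"] funpow_matrix_scale[of i M c v]
    by (simp add: algebra_simps)
  show ?A
    unfolding eq unfolding poly_act_def *
    by (simp add: vector_ssub_ldistrib sum_subtractf vector_smult_assoc mult.commute)
  show ?B
    unfolding eq unfolding poly_act_def
    by (simp add: vec.linear_sum[OF matrix_vector_mul_linear_gen] vec.scale_sum_right vector_scalar_commute vector_smult_assoc)
qed

text \<open>Summing the recurrence bounds a partial sum \<open>s\<close> by
  \<open>a 0 + c * s + suminf e\<close>, which can be solved for \<open>s\<close> because
  \<open>c < 1\<close>.\<close>

lemma summable_affine_recurrence: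
  fixes a e :: "nat \<Rightarrow> real"
  assumes a: "\<And>k. 0 \<le> a k" and e: "summable e" "\<And>k. 0 \<le> e k" and c: "c < 1"
    and rec: "\<And>k. a (Suc k) \<le> c * a k + e k"
  shows "summable a"
proof (rule summableI_nonneg_bounded)
  fix n
  have "(\<Sum>k<n. a k) \<le> (\<Sum>k<Suc n. a k)" using a by simp
  also have "\<dots> = a 0 + (\<Sum>k<n. a (Suc k))" by (rule sum.lessThan_Suc_shift)
  also have "\<dots> \<le> a 0 + (\<Sum>k<n. c * a k + e k)" by (intro add_left_mono sum_mono rec)
  also have "\<dots> \<le> a 0 + c * (\<Sum>k<n. a k) + suminf e"
    using sum_le_suminf[OF e(1), of "{..<n}"] e(2) by (simp add: sum.distrib sum_distrib_left)
  finally show "(\<Sum>k<n. a k) \<le> (a 0 + suminf e) / (1 - c)"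
    using c by (simp add: field_simps)
qed (use a in auto)

text \<open>
  Roots of the annihilating polynomial are split off one at a time: \<open>M - c\<close> is injective unless \<open>c\<close>
  is an eigenvalue, and for an eigenvalue \<open>M\<^sup>k v\<close> satisfies an affine recurrence with ratio \<open>c\<close>.
\<close>

lemma summable_powers_of_annihilated:
  fixes M :: "complex^'n^'n"
  assumes eig: "\<And>c. c \<in> spectrum M \<Longrightarrow> cmod c < 1"
  shows "p \<noteq> 0 \<Longrightarrow> poly_act M p v = 0 \<Longrightarrow> summable (\<lambda>k. norm (((*v) M ^^ k) v))"
proof (induction "degree p" arbitrary: p v)
  case 0
  then obtain c where p: "p = [:c:]" "c \<noteq> 0"
    by (metis degree_eq_zeroE pCons_0_0)
  with 0 have "v = 0" by (simp add: poly_act_def)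
  moreover have "((*v) M ^^ k) 0 = 0" for k by (induction k) simp_all
  ultimately show ?case by simp
next
  case (Suc n)
  then have "\<not> constant (poly p)" by (simp add: constant_degree)
  then obtain c where "poly p c = 0" using fundamental_theorem_of_algebra by blast
  then obtain q where q: "p = [:-c, 1:] * q" by (auto simp: poly_eq_0_iff_dvd)
  with Suc have q0: "q \<noteq> 0" by auto
  have deg: "n = degree q"
    using Suc.hyps(2) degree_mult_eq[of "[:-c, 1:]" q] q0 by (simp add: q del: mult_pCons_left)
  let ?y = "M *v v - c *s v"
  have pow: "((*v) M ^^ Suc k) v = c *s ((*v) M ^^ k) v + ((*v) M ^^ k) ?y" for k
    using funpow_matrix_add[where k=k and M=M and v="?y" and w="c *s v"] funpow_matrix_scale[of k M c v]
    by (simp add: algebra_simps funpow_swap1)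
  show ?case
  proof (cases "c \<in> spectrum M")
    case True
    have "poly_act M q ?y = 0" using Suc.prems q poly_act_linear_factor(1) by metis
    then have "summable (\<lambda>k. norm (((*v) M ^^ k) ?y))" using Suc.hyps(1) deg q0 by blast
    then show ?thesis
    proof (rule summable_affine_recurrence[rotated])
      show "cmod c < 1" using True eig by blast
      show "norm (((*v) M ^^ Suc k) v) \<le> cmod c * norm (((*v) M ^^ k) v) + norm (((*v) M ^^ k) ?y)" for k
        unfolding pow norm_vector_scalar_mult[symmetric] by (rule norm_triangle_ineq)
    qed auto
  next
    case False
    have "M *v poly_act M q v - c *s poly_act M q v = 0"
      using Suc.prems q poly_act_linear_factor(2) by metis
    then have "poly_act M q v = 0" using False by (auto simp: spectrum_def)
    then show ?thesis using Suc.hyps(1) deg q0 by blast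
  qed
qed

text \<open>A dimension count in place of the Cayley-Hamilton theorem: there are more powers with
  exponent at most \<open>DIM\<close> than the dimension of the matrix space allows to be
  independent.\<close>

lemma annihilating_coefficients:
  fixes M :: "real^'n^'n"
  obtains n c where "\<exists>i\<le>n. c i \<noteq> (0::real)" "(\<Sum>i\<le>n. c i *\<^sub>R mat_pow M i) = 0"
proof -
  let ?n = "DIM(real^'n^'n)"
  show ?thesis
  proof (cases "inj_on (mat_pow M) {..?n}")
    case True
    then have "card (mat_pow M ` {..?n}) > ?n" by (simp add: card_image)
    then have "dependent (mat_pow M ` {..?n})" by (intro dependent_biggerset) auto
    then obtain t u where t: "finite t" "t \<subseteq> mat_pow M ` {..?n}" "\<exists>v\<in>t. u v \<noteq> 0" "(\<Sum>v\<in>t. u v *\<^sub>R v) = 0"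
      unfolding real_vector.dependent_explicit by blast
    define c where "c i = (if mat_pow M i \<in> t then u (mat_pow M i) else 0)" for i
    show ?thesis
    proof (rule that[of ?n c])
      show "\<exists>i\<le>?n. c i \<noteq> 0" using t(2,3) by (fastforce simp: c_def)
      have "(\<Sum>i\<le>?n. c i *\<^sub>R mat_pow M i) = (\<Sum>v\<in>mat_pow M ` {..?n}. (if v \<in> t then u v else 0) *\<^sub>R v)"
        unfolding c_def by (subst sum.reindex[OF True]) simp
      also have "\<dots> = (\<Sum>v\<in>t. u v *\<^sub>R v)"
        by (rule sum.mono_neutral_cong_right) (use t in auto)
      finally show "(\<Sum>i\<le>?n. c i *\<^sub>R mat_pow M i) = 0" using t(4) by simp
    qed
  next
    case False
    \<comment> \<open>Linear dependence speaks of the set of powers and does not see repetitions. If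
      two powers coincide, their difference is the desired relation.\<close>
    then obtain i j where ij: "i \<le> ?n" "j \<le> ?n" "i \<noteq> j" "mat_pow M i = mat_pow M j"
      by (auto simp: inj_on_def)
    define c :: "nat \<Rightarrow> real" where "c k = (if k = i then 1 else 0) - (if k = j then 1 else 0)" for k
    show ?thesis
    proof (rule that[of ?n c])
      show "\<exists>i\<le>?n. c i \<noteq> 0" using ij by (auto simp: c_def intro!: exI[of _ i])
      show "(\<Sum>i\<le>?n. c i *\<^sub>R mat_pow M i) = 0"
        using ij by (simp add: c_def scaleR_diff_left sum_subtractf if_distrib[of "\<lambda>x. x *\<^sub>R _"] sum.delta cong: if_cong)
    qed
  qed
qed

lemma complex_matrix_sum_scaleR:
  "complex_matrix (\<Sum>i\<in>I. c i *\<^sub>R M i) *v v = (\<Sum>i\<in>I. complex_of_real (c i) *s (complex_matrix (M i) *v v))"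
  by (simp add: complex_matrix_def matrix_vector_mult_def vec_eq_iff sum_distrib_left sum_distrib_right
      mult.assoc) (intro allI sum.swap)

lemma annihilating_polynomial:
  fixes M :: "real^'n^'n"
  obtains p where "p \<noteq> 0" "\<And>v. poly_act (complex_matrix M) p v = 0"
proof -
  obtain n c where c: "\<exists>i\<le>n. c i \<noteq> (0::real)" "(\<Sum>i\<le>n. c i *\<^sub>R mat_pow M i) = 0"
    by (rule annihilating_coefficients)
  define p where "p = (\<Sum>i\<le>n. monom (complex_of_real (c i)) i)"
  have co: "coeff p i = (if i \<le> n then complex_of_real (c i) else 0)" for i
    by (simp add: p_def coeff_sum if_distrib cong: if_cong)
  have deg: "degree p \<le> n" by (rule degree_le) (simp add: co)
  show ?thesis
  proof (rule that[of p])
    show "p \<noteq> 0" using c(1) co by (metis coeff_0 of_real_eq_0_iff)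
    show "poly_act (complex_matrix M) p v = 0" for v
    proof -
      have "poly_act (complex_matrix M) p v
          = (\<Sum>i\<le>n. complex_of_real (c i) *s (complex_matrix (mat_pow M i) *v v))"
        unfolding poly_act_atMost[OF deg] by (simp add: co funpow_complex_matrix)
      also have "\<dots> = 0"
        unfolding complex_matrix_sum_scaleR[symmetric] c(2) by (simp add: complex_matrix_def matrix_vector_mult_def vec_eq_iff)
      finally show ?thesis .
    qed
  qed
qed

text \<open>Every eigenvalue is a root of the annihilating polynomial. Finiteness is what lets the
  \<open>Max\<close> in \<open>spectral_radius\<close> bound each eigenvalue.\<close>

lemma finite_spectrum: "finite (spectrum (complex_matrix M))"
proof -
  let ?M = "complex_matrix M"
  obtain p where p: "p \<noteq> 0" "\<And>v. poly_act ?M p v = 0" by (rule annihilating_polynomial) blast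
  have "spectrum ?M \<subseteq> {c. poly p c = 0}"
  proof
    fix c assume "c \<in> spectrum ?M"
    then obtain v where v: "v \<noteq> 0" "?M *v v = c *s v" by (auto simp: spectrum_def)
    have "((*v) ?M ^^ k) v = c ^ k *s v" for k
      by (induction k) (simp_all add: v vector_scalar_commute vector_smult_assoc mult.commute)
    then have "poly_act ?M p v = poly p c *s v"
      by (simp add: poly_act_def poly_altdef vec.scale_sum_left vector_smult_assoc)
    then show "c \<in> {c. poly p c = 0}" using p v by simp
  qed
  then show ?thesis using poly_roots_finite[OF p(1)] finite_subset by blast
qed

text \<open>Column \<open>j\<close> of \<open>M^k\<close> is the \<open>k\<close>-th iterate applied
  to the \<open>j\<close>-th unit vector, and the norms of these iterates are even summable.\<close>

lemma stable_powers_tendsto_0: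
  assumes "stable M"
  shows "(\<lambda>k. mat_pow M k) \<longlonglongrightarrow> 0"
proof (intro vec_tendstoI)
  fix i j
  let ?M = "complex_matrix M"
  obtain p where p: "p \<noteq> 0" "\<And>v. poly_act ?M p v = 0" by (rule annihilating_polynomial) blast
  have "cmod c < 1" if "c \<in> spectrum ?M" for c
  proof -
    have "cmod c \<le> spectral_radius M"
      unfolding spectral_radius_def using that finite_spectrum by (intro Max_ge) auto
    then show ?thesis using assms by (simp add: stable_def)
  qed
  then have "summable (\<lambda>k. norm (((*v) ?M ^^ k) (axis j 1)))"
    using summable_powers_of_annihilated p by blast
  then have "(\<lambda>k. norm (((*v) ?M ^^ k) (axis j 1))) \<longlonglongrightarrow> 0" by (rule summable_LIMSEQ_zero)
  then have "(\<lambda>k. (((*v) ?M ^^ k) (axis j 1)) $ i) \<longlonglongrightarrow> 0 $ i"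
    by (intro tendsto_vec_nth) (simp add: tendsto_norm_zero_iff)
  moreover have "(((*v) ?M ^^ k) (axis j 1)) $ i = complex_of_real (mat_pow M k $ i $ j)" for k
    unfolding funpow_complex_matrix
    by (simp add: complex_matrix_def matrix_vector_mult_def axis_def
        if_distrib[of "\<lambda>x. _ * x"] cong: if_cong)
  ultimately have "(\<lambda>k. complex_of_real (mat_pow M k $ i $ j)) \<longlonglongrightarrow> complex_of_real 0"
    by simp
  then show "(\<lambda>k. mat_pow M k $ i $ j) \<longlonglongrightarrow> 0 $ i $ j"
    by (simp only: tendsto_of_real_iff zero_index)
qed

section \<open>Lyapunov equations\<close>

lemma bounded_bilinear_matrix_mult:
  "bounded_bilinear ((**) :: real^'m^'n \<Rightarrow> real^'k^'m \<Rightarrow> real^'k^'n)"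
proof -
  have "bilinear ((**) :: real^'m^'n \<Rightarrow> real^'k^'m \<Rightarrow> real^'k^'n)"
    unfolding bilinear_def
    by (auto intro!: linearI simp: matrix_add_ldistrib matrix_matrix_mult_def vec_eq_iff
        algebra_simps sum.distrib sum_distrib_left)
  then show ?thesis by (simp add: bilinear_conv_bounded_bilinear)
qed

lemma bounded_linear_transpose: "bounded_linear (transpose :: real^'m^'n \<Rightarrow> real^'n^'m)"
  unfolding linear_conv_bounded_linear[symmetric]
  by (auto intro!: linearI simp: transpose_def vec_eq_iff)

lemma norm_transpose: "norm (transpose M) = norm (M :: real^'m^'n)"
proof -
  have "transpose M \<bullet> transpose M = M \<bullet> M"
    unfolding inner_vec_def transpose_def by simp (rule sum.swap)
  then show ?thesis by (simp add: norm_eq_sqrt_inner)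
qed

text \<open>The norm of the matrix type is the Frobenius norm, so Cauchy-Schwarz applied to each
  row-column product suffices.\<close>

lemma norm_matrix_mult_le:
  fixes M :: "real^'m^'n" and N :: "real^'k^'m"
  shows "norm (M ** N) \<le> norm M * norm N"
proof -
  have row: "(M ** N) $ i $ j = (M $ i) \<bullet> (transpose N $ j)" for i j
    by (simp add: matrix_matrix_mult_def inner_vec_def transpose_def)
  have "(norm (M ** N))\<^sup>2 = (\<Sum>i\<in>UNIV. \<Sum>j\<in>UNIV. ((M $ i) \<bullet> (transpose N $ j))\<^sup>2)"
    unfolding power2_norm_eq_inner inner_vec_def[of "M ** N"] 
    by (simp add: inner_vec_def[of "(M ** N) $ _"] row power2_eq_square)
  also have "\<dots> \<le> (\<Sum>i\<in>UNIV. \<Sum>j\<in>UNIV. (norm (M $ i))\<^sup>2 * (norm (transpose N $ j))\<^sup>2)"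
    by (intro sum_mono) (simp add: Cauchy_Schwarz_ineq power2_norm_eq_inner)
  also have "\<dots> = (norm M)\<^sup>2 * (norm (transpose N))\<^sup>2"
    by (simp add: power2_norm_eq_inner inner_vec_def[of M] inner_vec_def[of "transpose N"] sum_product)
  finally show ?thesis
    unfolding norm_transpose power_mult_distrib[symmetric] by (rule power2_le_imp_le) simp
qed

section \<open>Matrix powers and their geometric decay\<close>

lemma mat_pow_add: "mat_pow M (j + k) = mat_pow M j ** mat_pow M k"
  by (induction j) (simp_all add: matrix_mul_assoc)

lemma mat_pow_mult: "mat_pow M (j * k) = mat_pow (mat_pow M k) j"
  by (induction j) (simp_all add: mat_pow_add)

lemma mat_pow_Suc_right: "mat_pow M (Suc k) = mat_pow M k ** M"
  using mat_pow_add[of M k 1] by simp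

lemma transpose_mat_pow: "transpose (mat_pow M k) = mat_pow (transpose M) k"
proof (induction k)
  case (Suc k)
  have "transpose (mat_pow M (Suc k)) = transpose M ** transpose (mat_pow M k)"
    by (simp add: mat_pow_Suc_right matrix_transpose_mul del: mat_pow.simps)
  with Suc show ?case by simp
qed simp

text \<open>The factor \<open>norm (mat 1)\<close> is there because the Frobenius norm of the
  identity is not 1 in general.\<close>

lemma norm_mat_pow_le: "norm (mat_pow M k) \<le> norm (mat 1 :: real^'n^'n) * norm M ^ k" for M :: "real^'n^'n"
proof (induction k)
  case (Suc k)
  then have "norm (mat_pow M (Suc k)) \<le> norm M * (norm (mat 1 :: real^'n^'n) * norm M ^ k)"
    using norm_matrix_mult_le[of M "mat_pow M k"] by (simp add: order_trans mult_left_mono)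
  then show ?case by (simp add: mult_ac)
qed simp

lemma tendsto_mat_pow: "((\<lambda>M. mat_pow M k) \<longlongrightarrow> mat_pow M k) (nhds M)" for M :: "real^'n^'n"
  by (induction k) (auto intro!: bounded_bilinear.tendsto[OF bounded_bilinear_matrix_mult] filterlim_ident)

text \<open>The constants are parameters, not existentially quantified, so that one pair can serve a
  whole neighbourhood.\<close>

definition geometric_powers :: "real \<Rightarrow> real \<Rightarrow> real^'n^'n \<Rightarrow> bool" where
  "geometric_powers c q M \<longleftrightarrow> (\<forall>k. norm (mat_pow M k) \<le> c * q ^ k)"

text \<open>A single power of norm below 1/2 forces geometric decay, by writing an exponent
  \<open>t\<close> as a multiple of \<open>k\<close> plus a remainder. That this one power is small
  is an open condition on the matrix, so the constants persist nearby.\<close>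

lemma stable_geometric_nearby:
  fixes M :: "real^'n^'n"
  assumes "stable M"
  obtains c q where "0 \<le> c" "0 < q" "q < 1" "geometric_powers c q M"
    "\<forall>\<^sub>F M' in nhds M. geometric_powers c q M'"
proof -
  let ?I = "norm (mat 1 :: real^'n^'n)"
  have "(\<lambda>k. norm (mat_pow M k)) \<longlonglongrightarrow> 0"
    using stable_powers_tendsto_0[OF assms] by (rule tendsto_norm_zero)
  then have "\<forall>\<^sub>F k in sequentially. norm (mat_pow M k) < 1/2"
    by (rule order_tendstoD) simp
  then obtain k0 where k0: "norm (mat_pow M k) < 1/2" if "k \<ge> k0" for k
    by (auto simp: eventually_sequentially)
  define k where "k = Suc k0"
  have k: "norm (mat_pow M k) < 1/2" "k > 0" using k0[of "Suc k0"] by (simp_all add: k_def del: mat_pow.simps)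
  \<comment> \<open>\<open>r\<close> bounds the norm of nearby matrices; \<open>r >= 1\<close> lets
    \<open>r ^ (t mod k)\<close> be replaced by \<open>r ^ k\<close>.\<close>
  define r where "r = norm M + 1"
  have r: "r \<ge> 1" "norm M < r" by (auto simp: r_def)
  \<comment> \<open>This gives \<open>q ^ k = 1/2\<close>. In \<open>c\<close>, the 2 pays for
    rounding \<open>t / k\<close> down, the two norms of the identity come from splitting the power,
    and \<open>r ^ k\<close> covers the remainder.\<close>
  define q where "q = 2 powr (- (1 / real k))"
  define c where "c = 2 * ?I * ?I * r ^ k"
  have q: "0 < q" "q < 1" using k(2) by (auto simp: q_def powr_less_one)
  have qpow: "(1/2) ^ (t div k) \<le> 2 * q ^ t" for t
  proof -
    have "real t \<le> real (k * (t div k)) + real k"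
      using mod_less_divisor[OF k(2), of t] div_mult_mod_eq[of t k]
      by (metis add_left_mono less_imp_le mult.commute of_nat_add of_nat_mono)
    then have *: "real t / real k \<le> real (t div k) + 1"
      using k(2) by (simp add: field_simps)
    have qt: "q ^ t = 2 powr (- (real t / real k))"
      unfolding q_def by (subst powr_power) simp_all
    have "(1/2) ^ (t div k) = 2 powr (- real (t div k))"
      by (simp add: powr_minus powr_realpow power_one_over divide_simps)
    also have "\<dots> \<le> 2 powr (1 - real t / real k)" using * by simp
    also have "\<dots> = 2 * q ^ t"
      by (simp add: qt powr_diff powr_minus_divide)
    finally show ?thesis .
  qed
  have geo: "geometric_powers c q M'" if M': "norm (mat_pow M' k) < 1/2" "norm M' < r" for M' :: "real^'n^'n"
    unfolding geometric_powers_def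
  proof
    fix t
    have "norm (mat_pow M' t) = norm (mat_pow (mat_pow M' k) (t div k) ** mat_pow M' (t mod k))"
      by (simp flip: mat_pow_mult mat_pow_add)
    also have "\<dots> \<le> norm (mat_pow (mat_pow M' k) (t div k)) * norm (mat_pow M' (t mod k))"
      by (rule norm_matrix_mult_le)
    also have "\<dots> \<le> (?I * norm (mat_pow M' k) ^ (t div k)) * (?I * norm M' ^ (t mod k))"
      by (intro mult_mono norm_mat_pow_le) auto
    also have "\<dots> \<le> (?I * (1/2) ^ (t div k)) * (?I * r ^ k)"
    proof (intro mult_mono mult_left_mono)
      show "norm M' ^ (t mod k) \<le> r ^ k"
      proof -
        have "norm M' ^ (t mod k) \<le> r ^ (t mod k)" using M' by (intro power_mono) auto
        also have "\<dots> \<le> r ^ k" using r k(2) by (intro power_increasing) auto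
        finally show ?thesis .
      qed
    qed (use M' r in \<open>auto intro!: power_mono\<close>)
    also have "\<dots> \<le> (?I * (2 * q ^ t)) * (?I * r ^ k)"
      using qpow r by (intro mult_right_mono mult_left_mono) auto
    finally show "norm (mat_pow M' t) \<le> c * q ^ t" by (simp add: c_def mult_ac)
  qed
  have "\<forall>\<^sub>F M' in nhds M. norm (mat_pow M' k) < 1/2"
    by (rule order_tendstoD[OF tendsto_norm[OF tendsto_mat_pow]]) (rule k(1))
  moreover have "\<forall>\<^sub>F M' in nhds M. norm M' < r"
    by (rule order_tendstoD[OF tendsto_norm[OF filterlim_ident]]) (rule r(2))
  ultimately have "\<forall>\<^sub>F M' in nhds M. geometric_powers c q M'"
    by eventually_elim (rule geo)
  moreover have "geometric_powers c q M" using geo k r by blast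
  moreover have "0 \<le> c" using r by (simp add: c_def)
  ultimately show ?thesis using that q by blast
qed

section \<open>Series solution of the discrete Lyapunov equation\<close>

definition lyapunov_term :: "real^'n^'n \<Rightarrow> real^'n^'n \<Rightarrow> nat \<Rightarrow> real^'n^'n" where
  "lyapunov_term M Y k = mat_pow M k ** Y ** transpose (mat_pow M k)"

text \<open>One series for both objects: the closed loop with the noise covariance gives the state
  covariance, the transposed closed loop with the one-step cost gives the value matrix.\<close>

definition lyapunov_sum :: "real^'n^'n \<Rightarrow> real^'n^'n \<Rightarrow> real^'n^'n" where
  "lyapunov_sum M Y = (\<Sum>k. lyapunov_term M Y k)"

lemma norm_lyapunov_term:
  assumes "geometric_powers c q M"
  shows "norm (lyapunov_term M Y k) \<le> c\<^sup>2 * norm Y * (q\<^sup>2) ^ k"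
proof -
  have "norm (lyapunov_term M Y k) \<le> norm (mat_pow M k) * norm Y * norm (mat_pow M k)"
    unfolding lyapunov_term_def
    by (rule order_trans[OF norm_matrix_mult_le]) (simp add: norm_transpose mult_right_mono norm_matrix_mult_le)
  also have "\<dots> = (norm (mat_pow M k))\<^sup>2 * norm Y" by (simp add: power2_eq_square mult_ac)
  also have "\<dots> \<le> (c * q ^ k)\<^sup>2 * norm Y"
    using assms by (intro mult_right_mono power_mono) (auto simp: geometric_powers_def)
  finally show ?thesis by (simp add: power_mult_distrib mult_ac flip: power_mult)
qed

lemma summable_lyapunov_bound:
  assumes "0 < q" "q < (1::real)"
  shows "summable (\<lambda>k. c\<^sup>2 * y * (q\<^sup>2) ^ k)"
  using assms by (intro summable_mult summable_geometric) (simp add: power_less_one_iff)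

lemma summable_lyapunov_term:
  assumes "0 < q" "q < 1" "geometric_powers c q M"
  shows "summable (lyapunov_term M Y)"
  using summable_lyapunov_bound[OF assms(1,2)] norm_lyapunov_term[OF assms(3)]
  by (rule summable_comparison_test'[where N=0]) 

lemma lyapunov_sum_eq:
  assumes "0 < q" "q < 1" "geometric_powers c q M"
  shows "lyapunov_sum M Y = Y + M ** lyapunov_sum M Y ** transpose M"
proof -
  have sums: "summable (lyapunov_term M Y)" using assms by (rule summable_lyapunov_term)
  have bl: "bounded_linear (\<lambda>X. M ** X ** transpose M)"
    using bounded_linear_compose[OF bounded_bilinear.bounded_linear_left[OF bounded_bilinear_matrix_mult]
        bounded_bilinear.bounded_linear_right[OF bounded_bilinear_matrix_mult]] by blast
  have "lyapunov_term M Y (Suc k) = M ** lyapunov_term M Y k ** transpose M" for k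
    by (simp add: lyapunov_term_def matrix_transpose_mul matrix_mul_assoc)
  then have "(\<Sum>k. lyapunov_term M Y (Suc k)) = M ** lyapunov_sum M Y ** transpose M"
    unfolding lyapunov_sum_def by (simp add: bounded_linear.suminf[OF bl sums])
  then show ?thesis
    unfolding lyapunov_sum_def suminf_split_head[OF sums] by (simp add: lyapunov_term_def diff_eq_eq add.commute)
qed

text \<open>The difference of two solutions is a fixed point of \<open>X -> M X M^T\<close>, hence
  equals every term of its own convergent series, and these terms tend to 0. Uniqueness also gives
  meaning to the \<open>THE\<close> in \<open>value_matrix\<close>.\<close>

lemma lyapunov_unique:
  assumes "0 < q" "q < 1" "geometric_powers c q M"
    and X: "X = Y + M ** X ** transpose M"
  shows "X = lyapunov_sum M Y"
proof -
  let ?D = "X - lyapunov_sum M Y"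
  have "?D = M ** ?D ** transpose M"
    using X lyapunov_sum_eq[OF assms(1-3), of Y]
    by (simp add: bounded_bilinear.diff_left[OF bounded_bilinear_matrix_mult]
        bounded_bilinear.diff_right[OF bounded_bilinear_matrix_mult])
      (metis add_diff_cancel_left)
  then have D: "?D = lyapunov_term M ?D k" for k
  proof (induction k)
    case (Suc k)
    have "lyapunov_term M ?D (Suc k) = M ** lyapunov_term M ?D k ** transpose M"
      by (simp add: lyapunov_term_def matrix_transpose_mul matrix_mul_assoc)
    with Suc show ?case by metis
  qed (simp add: lyapunov_term_def)
  have "lyapunov_term M ?D \<longlonglongrightarrow> 0"
    using assms by (intro summable_LIMSEQ_zero summable_lyapunov_term)
  then have "(\<lambda>k::nat. ?D) \<longlonglongrightarrow> 0" unfolding D[symmetric] .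
  then show ?thesis by (simp add: LIMSEQ_const_iff)
qed

lemma transpose_add: "transpose (M + N) = transpose M + (transpose N :: 'a::plus^'m^'n)"
  by (simp add: transpose_def vec_eq_iff)

text \<open>The transpose solves the same equation, so uniqueness applies.\<close>

lemma transpose_lyapunov_sum:
  assumes "0 < q" "q < 1" "geometric_powers c q M" "transpose Y = Y"
  shows "transpose (lyapunov_sum M Y) = lyapunov_sum M Y"
proof (rule lyapunov_unique[OF assms(1-3)])
  show "transpose (lyapunov_sum M Y) = Y + M ** transpose (lyapunov_sum M Y) ** transpose M"
    by (subst (1) lyapunov_sum_eq[OF assms(1-3)])
      (simp add: transpose_add matrix_transpose_mul assms(4) matrix_mul_assoc)
qed

lemma geometric_powers_transpose: "geometric_powers c q (transpose M) \<longleftrightarrow> geometric_powers c q M"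
  by (simp add: geometric_powers_def norm_transpose flip: transpose_mat_pow)

text \<open>With common \<open>c\<close> and \<open>q\<close> the series has a majorant independent
  of the matrix, so it converges uniformly and the limits may be exchanged. As the set with these
  constants contains a neighbourhood of \<open>M\<close>, the limit within it is a full
  limit.\<close>

lemma tendsto_lyapunov_sum:
  assumes q: "0 < q" "q < 1" and ev: "\<forall>\<^sub>F M' in nhds M. geometric_powers c q M'"
  shows "((\<lambda>M'. lyapunov_sum M' Y) \<longlongrightarrow> lyapunov_sum M Y) (nhds M)"
proof -
  let ?S = "{M'. geometric_powers c q M'}"
  have M: "M \<in> ?S" using eventually_nhds_x_imp_x[OF ev] by simp
  have lim: "((\<lambda>M'. lyapunov_term M' Y k) \<longlongrightarrow> lyapunov_term M Y k) (at M within ?S)" for k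
    unfolding lyapunov_term_def
    by (intro bounded_bilinear.tendsto[OF bounded_bilinear_matrix_mult] tendsto_const
        bounded_linear.tendsto[OF bounded_linear_transpose] tendsto_mat_pow[THEN tendsto_mono[rotated]])
      (auto simp: at_within_le_nhds)
  have "uniform_limit ?S (\<lambda>n M'. \<Sum>k<n. lyapunov_term M' Y k) (\<lambda>M'. lyapunov_sum M' Y) sequentially"
    unfolding lyapunov_sum_def
    by (rule Weierstrass_m_test[where M = "\<lambda>k. c\<^sup>2 * norm Y * (q\<^sup>2) ^ k"])
      (simp_all only: mem_Collect_eq norm_lyapunov_term summable_lyapunov_bound[OF q])
  then have "((\<lambda>M'. lyapunov_sum M' Y) \<longlongrightarrow> lyapunov_sum M Y) (at M within ?S)"
  proof (rule swap_uniform_limit[rotated 2])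
    show "(\<lambda>n. \<Sum>k<n. lyapunov_term M Y k) \<longlonglongrightarrow> lyapunov_sum M Y"
      unfolding lyapunov_sum_def using summable_lyapunov_term[OF q] M by (auto intro: summable_LIMSEQ)
  qed (auto intro!: always_eventually tendsto_sum lim)
  moreover obtain O' where O': "open O'" "M \<in> O'" "O' \<subseteq> ?S"
    using ev unfolding eventually_nhds by blast
  ultimately have "((\<lambda>M'. lyapunov_sum M' Y) \<longlongrightarrow> lyapunov_sum M Y) (at M)"
    using tendsto_within_subset at_within_open by metis
  then show ?thesis by (rule tendsto_at_iff_tendsto_nhds[THEN iffD1])
qed

section \<open>The gradient of the cost\<close>

lemmas matrix_mult_distribs =
  bounded_bilinear.add_left[OF bounded_bilinear_matrix_mult]
  bounded_bilinear.add_right[OF bounded_bilinear_matrix_mult]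

lemma inner_eq_trace: "E \<bullet> X = trace (transpose E ** X)" for E X :: "real^'m^'n"
  unfolding inner_vec_def trace_def matrix_matrix_mult_def transpose_def by simp (rule sum.swap)

definition cost_matrix :: "real^'x^'x \<Rightarrow> real^'u^'u \<Rightarrow> real^'x^'u \<Rightarrow> real^'x^'x" where
  "cost_matrix Q R K = Q + transpose K ** R ** K"

text \<open>The Bellman operator of the gain \<open>K + E\<close>, applied to the value matrix of
  \<open>K\<close>, is exactly quadratic in \<open>E\<close>. Its linear coefficient
  \<open>F\<close> becomes half the gradient once multiplied by the covariance.\<close>

lemma cost_matrix_perturb:
  fixes A :: "real^'x^'x" and B :: "real^'u^'x" and K E :: "real^'x^'u"
  defines "M \<equiv> A + B ** K"
  assumes R: "transpose R = R" and P: "transpose P = P"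
    and eq: "P = cost_matrix Q R K + transpose M ** P ** M"
  defines "F \<equiv> R ** K + transpose B ** P ** M" and "G \<equiv> R + transpose B ** P ** B"
  shows "cost_matrix Q R (K + E) + transpose (A + B ** (K + E)) ** P ** (A + B ** (K + E))
    = P + transpose E ** F + transpose F ** E + transpose E ** G ** E"
proof -
  have "A + B ** (K + E) = M + B ** E" by (simp add: M_def matrix_mult_distribs add.assoc)
  note e1 = this
  have e2: "transpose (M + B ** E) ** P ** (M + B ** E)
      = transpose M ** P ** M + transpose E ** (transpose B ** P ** M)
        + transpose M ** P ** B ** E + transpose E ** (transpose B ** P ** B) ** E"
    by (simp only: matrix_mult_distribs transpose_add matrix_transpose_mul matrix_mul_assoc add_ac)
  have e3: "cost_matrix Q R (K + E) = cost_matrix Q R K + transpose E ** (R ** K)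
      + transpose K ** R ** E + transpose E ** R ** E"
    by (simp only: cost_matrix_def matrix_mult_distribs transpose_add matrix_transpose_mul
        matrix_mul_assoc add_ac)
  have *: "cost_matrix Q R (K + E) + transpose (A + B ** (K + E)) ** P ** (A + B ** (K + E))
    = cost_matrix Q R K + transpose E ** (R ** K) + transpose K ** R ** E + transpose E ** R ** E
      + (transpose M ** P ** M + transpose E ** (transpose B ** P ** M)
        + transpose M ** P ** B ** E + transpose E ** (transpose B ** P ** B) ** E)"
    by (simp only: e1 e2 e3)
  have F': "transpose F = transpose K ** R + transpose M ** P ** B"
    by (simp only: F_def transpose_add matrix_transpose_mul R P transpose_transpose matrix_mul_assoc)
  have "P + transpose E ** F + transpose F ** E + transpose E ** G ** E
    = cost_matrix Q R K + transpose M ** P ** M + transpose E ** F + transpose F ** E + transpose E ** G ** E"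
    using arg_cong[OF eq, of "\<lambda>X. X + transpose E ** F + transpose F ** E + transpose E ** G ** E"] .
  note ** = this
  show ?thesis
    unfolding * ** unfolding F' by (simp only: F_def G_def matrix_mult_distribs matrix_mul_assoc add_ac)
qed

text \<open>Only the value matrix of the old gain and the covariance of the new gain enter the
  right-hand side: the cost difference is the Bellman residual of \<open>P\<close> at
  \<open>K'\<close>, averaged over the stationary covariance \<open>X'\<close>. The identity is
  exact, with no remainder term.\<close>

lemma performance_difference:
  fixes A :: "real^'x^'x" and B :: "real^'u^'x" and K K' :: "real^'x^'u"
  defines "M \<equiv> A + B ** K" and "M' \<equiv> A + B ** K'"
  assumes R: "transpose R = R" and P: "transpose P = P" "P = cost_matrix Q R K + transpose M ** P ** M"
    and X: "X = C + M ** X ** transpose M"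
    and X': "transpose X' = X'" "X' = C + M' ** X' ** transpose M'"
  defines "F \<equiv> R ** K + transpose B ** P ** M" and "G \<equiv> R + transpose B ** P ** B"
  shows "trace (cost_matrix Q R K' ** X') - trace (cost_matrix Q R K ** X)
    = (K' - K) \<bullet> (2 *\<^sub>R (F ** X') + G ** (K' - K) ** X')"
proof -
  let ?E = "K' - K"
  have swap: "trace (transpose N ** P ** N ** Y) = trace (P ** (N ** Y ** transpose N))" for N Y :: "real^'x^'x"
    using trace_mul_sym[of "transpose N" "P ** N ** Y"] by (simp add: matrix_mul_assoc)
  have "trace (P ** X) = trace (cost_matrix Q R K ** X) + trace (transpose M ** P ** M ** X)"
    by (subst P(2)) (simp add: matrix_mult_distribs trace_add)
  moreover have "trace (P ** X) = trace (P ** C) + trace (P ** (M ** X ** transpose M))"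
    by (subst X) (simp add: matrix_mult_distribs trace_add)
  \<comment> \<open>Duality of the two Lyapunov equations: pairing each with the solution of the
    other produces a common term, which cancels.\<close>
  ultimately have J: "trace (cost_matrix Q R K ** X) = trace (P ** C)"
    by (simp add: swap)
  have "cost_matrix Q R K' + transpose M' ** P ** M'
      = P + transpose ?E ** F + transpose F ** ?E + transpose ?E ** G ** ?E"
    using cost_matrix_perturb[OF R P(1) P(2)[unfolded M_def], of ?E]
    by (simp add: F_def G_def M_def M'_def)
  then have "trace ((cost_matrix Q R K' + transpose M' ** P ** M') ** X')
      = trace ((P + transpose ?E ** F + transpose F ** ?E + transpose ?E ** G ** ?E) ** X')"
    by simp
  moreover have "trace (P ** X') = trace (P ** C) + trace (P ** (M' ** X' ** transpose M'))"
    by (subst X'(2)) (simp add: matrix_mult_distribs trace_add)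
  \<comment> \<open>By symmetry of \<open>X'\<close> the two linear terms agree; this is the origin
    of the factor 2 in the gradient.\<close>
  moreover have "trace (transpose F ** ?E ** X') = trace (transpose ?E ** F ** X')"
  proof -
    have "trace (transpose F ** ?E ** X') = trace (transpose (transpose F ** ?E ** X'))"
      by (simp add: trace_def transpose_def)
    also have "\<dots> = trace (X' ** (transpose ?E ** F))"
      by (simp add: matrix_transpose_mul X'(1) matrix_mul_assoc)
    finally show ?thesis by (simp add: trace_mul_sym[of X'])
  qed
  ultimately have "trace (cost_matrix Q R K' ** X') - trace (cost_matrix Q R K ** X)
      = 2 * trace (transpose ?E ** F ** X') + trace (transpose ?E ** G ** ?E ** X')"
    by (simp add: J matrix_mult_distribs trace_add swap)
  then show ?thesis
    unfolding inner_add_right inner_scaleR_right unfolding inner_eq_trace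
    by (simp add: matrix_mul_assoc)
qed

text \<open>
  The secant formula above evaluates the covariance at the perturbed gain \<open>K'\<close>, so that continuity
  of the covariance, without its derivative, already gives the gradient.
\<close>

lemma GDERIV_of_secant:
  fixes J :: "'a::real_inner \<Rightarrow> real"
  assumes ev: "\<forall>\<^sub>F y in nhds x. J y - J x = (y - x) \<bullet> \<phi> y" and \<phi>: "(\<phi> \<longlongrightarrow> g) (nhds x)"
  shows "GDERIV J x :> g"
  unfolding gderiv_def has_derivative_within
proof (intro conjI)
  have "((\<lambda>y. norm (\<phi> y - g)) \<longlongrightarrow> 0) (at x)"
    using tendsto_norm_zero[OF LIM_zero[OF \<phi>]] by (rule tendsto_mono[OF at_within_le_nhds])
  then show "((\<lambda>y. (1 / norm (y - x)) *\<^sub>R (J y - (J x + (y - x) \<bullet> g))) \<longlongrightarrow> 0) (at x)"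
  proof (rule Lim_null_comparison[rotated])
    show "\<forall>\<^sub>F y in at x. norm ((1 / norm (y - x)) *\<^sub>R (J y - (J x + (y - x) \<bullet> g))) \<le> norm (\<phi> y - g)"
      using filter_leD[OF at_within_le_nhds ev]
    proof eventually_elim
      case (elim y)
      have "J y - (J x + (y - x) \<bullet> g) = (y - x) \<bullet> (\<phi> y - g)"
        using elim by (simp add: inner_diff_right)
      then show ?case
        using Cauchy_Schwarz_ineq2[of "y - x" "\<phi> y - g"]
        by (cases "y = x") (simp_all add: divide_simps mult.commute)
    qed
  qed
qed (rule bounded_linear_inner_left)

lemma GDERIV_unique: "GDERIV f x :> a \<Longrightarrow> GDERIV f x :> b \<Longrightarrow> a = b"
  unfolding gderiv_def by (drule (1) has_derivative_unique) (simp add: fun_eq_iff vector_eq_ldot)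

section \<open>Value matrix, state covariance and the gradient formula\<close>

lemma transpose_cost_matrix:
  "transpose Q = Q \<Longrightarrow> transpose R = R \<Longrightarrow> transpose (cost_matrix Q R K) = cost_matrix Q R K"
  by (simp add: cost_matrix_def transpose_add matrix_transpose_mul matrix_mul_assoc)

lemma stable_value_matrix:
  assumes st: "stable (closed_loop S K)" and sym: "transpose Q = Q" "transpose R = R"
  defines "P \<equiv> value_matrix Q R S K"
  shows "P = cost_matrix Q R K + transpose (closed_loop S K) ** P ** closed_loop S K" "transpose P = P"
proof -
  let ?M = "closed_loop S K" and ?H = "cost_matrix Q R K"
  obtain c q where q: "0 < q" "q < 1" and geo: "geometric_powers c q ?M"
    using stable_geometric_nearby[OF st] by blast
  from geo have geo': "geometric_powers c q (transpose ?M)" by (simp add: geometric_powers_transpose)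
  let ?L = "lyapunov_sum (transpose ?M) ?H"
  have eq: "P = ?L"
    unfolding P_def value_matrix_def cost_matrix_def[of Q R K, symmetric]
  proof (rule the_equality)
    show "?L = ?H + transpose ?M ** ?L ** ?M"
      using lyapunov_sum_eq[OF q geo', of ?H] by (simp only: transpose_transpose)
    show "X = ?L" if "X = ?H + transpose ?M ** X ** ?M" for X
      using lyapunov_unique[OF q geo', of X ?H] that by (simp only: transpose_transpose)
  qed
  show "P = ?H + transpose ?M ** P ** ?M"
    unfolding eq using lyapunov_sum_eq[OF q geo', of ?H] by (simp only: transpose_transpose)
  show "transpose P = P"
    unfolding eq by (rule transpose_lyapunov_sum[OF q geo' transpose_cost_matrix[OF sym]])
qed

lemma state_covariance_eq: "state_covariance C S K = lyapunov_sum (closed_loop S K) C"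
  by (simp add: state_covariance_def lyapunov_sum_def lyapunov_term_def)

text \<open>\<open>J\<close> is constrained only at gains whose closed loop decays geometrically.
  These contain a neighbourhood of \<open>K\<close>, and a derivative depends on nothing
  else.\<close>

theorem GDERIV_lqr:
  fixes A :: "real^'x^'x" and B :: "real^'u^'x"
  assumes sym: "transpose Q = Q" "transpose R = R" "transpose C = C"
    and st: "stable (closed_loop (A, B) K)"
    and J: "\<And>K' c q. 0 < q \<Longrightarrow> q < 1 \<Longrightarrow> geometric_powers c q (closed_loop (A, B) K') \<Longrightarrow>
      J K' = trace (cost_matrix Q R K' ** state_covariance C (A, B) K')"
  shows "GDERIV J K :> 2 *\<^sub>R ((R ** K + transpose B ** value_matrix Q R (A, B) K ** (A + B ** K))
    ** state_covariance C (A, B) K)"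
proof -
  let ?M = "\<lambda>K. A + B ** K" and ?X = "state_covariance C (A, B)"
  let ?P = "value_matrix Q R (A, B) K"
  let ?F = "R ** K + transpose B ** ?P ** ?M K" and ?G = "R + transpose B ** ?P ** B"
  have cl: "closed_loop (A, B) K' = ?M K'" for K' by (simp add: closed_loop_def)
  obtain c q where q: "0 < q" "q < 1" and geo: "geometric_powers c q (?M K)"
    and ev: "\<forall>\<^sub>F M' in nhds (?M K). geometric_powers c q M'"
    using stable_geometric_nearby[OF st] unfolding cl by blast
  have lim: "(?M \<longlongrightarrow> ?M K) (nhds K)"
    by (intro tendsto_add tendsto_const bounded_bilinear.tendsto[OF bounded_bilinear_matrix_mult] filterlim_ident)
  have "\<forall>\<^sub>F K' in nhds K. geometric_powers c q (?M K')"
    using ev lim by (rule eventually_compose_filterlim)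
  then have sec: "\<forall>\<^sub>F K' in nhds K. J K' - J K = (K' - K) \<bullet> (2 *\<^sub>R (?F ** ?X K') + ?G ** (K' - K) ** ?X K')"
  proof eventually_elim
    case (elim K')
    note P = stable_value_matrix[OF st sym(1,2)]
    show ?case
      unfolding J[OF q geo[folded cl]] J[OF q elim[folded cl]]
    proof (rule performance_difference[where C = C, OF sym(2) P(2) P(1)[unfolded cl]])
      show "?X K = C + ?M K ** ?X K ** transpose (?M K)"
        unfolding state_covariance_eq cl by (rule lyapunov_sum_eq[OF q geo])
      show "?X K' = C + ?M K' ** ?X K' ** transpose (?M K')"
        unfolding state_covariance_eq cl by (rule lyapunov_sum_eq[OF q elim])
      show "transpose (?X K') = ?X K'"
        unfolding state_covariance_eq cl by (rule transpose_lyapunov_sum[OF q elim sym(3)])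
    qed
  qed
  have X: "(?X \<longlongrightarrow> ?X K) (nhds K)"
    unfolding state_covariance_eq cl by (rule filterlim_compose[OF tendsto_lyapunov_sum[OF q ev] lim])
  \<comment> \<open>The quadratic term carries the factor \<open>K' - K\<close> and vanishes in the
    limit.\<close>
  have "((\<lambda>K'. 2 *\<^sub>R (?F ** ?X K') + ?G ** (K' - K) ** ?X K') \<longlongrightarrow> 2 *\<^sub>R (?F ** ?X K) + ?G ** (K - K) ** ?X K) (nhds K)"
    by (intro tendsto_add tendsto_const tendsto_scaleR tendsto_diff
        bounded_bilinear.tendsto[OF bounded_bilinear_matrix_mult] filterlim_ident X)
  then show ?thesis
    using GDERIV_of_secant[OF sec] by (simp add: bounded_bilinear.zero_left[OF bounded_bilinear_matrix_mult]
        bounded_bilinear.zero_right[OF bounded_bilinear_matrix_mult])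
qed

section \<open>Expected costs and noise moments\<close>

lemma cesaro_mean_tendsto:
  fixes y :: "nat \<Rightarrow> real"
  assumes "y \<longlonglongrightarrow> L"
  shows "(\<lambda>n. 1 / real n * (\<Sum>t<n. y t)) \<longlonglongrightarrow> L"
proof (rule LIMSEQ_I)
  fix e :: real assume e: "0 < e"
  obtain n0 where n0: "\<bar>y t - L\<bar> < e / 2" if "t \<ge> n0" for t
    using LIMSEQ_D[OF assms, of "e/2"] e by auto
  define D where "D = (\<Sum>t<n0. \<bar>y t - L\<bar>)"
  obtain n1 :: nat where n1: "2 * D / e < real n1" using reals_Archimedean2 by blast
  show "\<exists>no. \<forall>n\<ge>no. norm (1 / real n * (\<Sum>t<n. y t) - L) < e"
  proof (intro exI allI impI)
    fix n assume n: "n \<ge> max n1 (Suc n0)"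
    have "\<bar>\<Sum>t<n. y t - L\<bar> \<le> (\<Sum>t<n. \<bar>y t - L\<bar>)" by (rule sum_abs)
    also have "\<dots> = D + (\<Sum>t\<in>{n0..<n}. \<bar>y t - L\<bar>)"
      unfolding D_def using n by (subst sum.union_disjoint[symmetric]) (auto intro!: sum.cong)
    also have "(\<Sum>t\<in>{n0..<n}. \<bar>y t - L\<bar>) \<le> (\<Sum>t\<in>{n0..<n}. e / 2)"
      using n0 by (intro sum_mono) (auto intro: less_imp_le)
    also have "\<dots> \<le> real n * (e / 2)" using e by (simp add: mult_right_mono)
    also have "D < real n * (e / 2)"
    proof -
      have "2 * D / e < real n" using n1 n by linarith
      then show ?thesis using e by (simp add: field_simps)
    qed
    finally have "\<bar>\<Sum>t<n. y t - L\<bar> < real n * e" by (simp add: mult.commute)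
    moreover have "1 / real n * (\<Sum>t<n. y t) - L = (\<Sum>t<n. y t - L) / real n"
      using n by (simp add: sum_subtractf field_simps)
    ultimately show "norm (1 / real n * (\<Sum>t<n. y t) - L) < e"
      using n by (simp add: divide_less_eq mult.commute)
  qed
qed

text \<open>A quadratic cost sees the noise only through these two moments. The case of zero
  variance is the point mass that a singular covariance produces.\<close>

lemma centered_gaussian_projection_moments:
  assumes W: "centered_gaussian C W" and C: "psd_matrix C"
  shows "has_bochner_integral W (\<lambda>w. (v \<bullet> w)\<^sup>2) (v \<bullet> (C *v v))"
    and "has_bochner_integral W (\<lambda>w. v \<bullet> w) 0"
proof -
  let ?s = "v \<bullet> (C *v v)" and ?D = "distr W borel (\<lambda>w. v \<bullet> w)"
  have sets: "sets W = sets borel" using W by (simp add: centered_gaussian_def)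
  have D: "?D = (if ?s = 0 then return borel 0 else density lborel (normal_density 0 (sqrt ?s)))"
    using W by (simp add: centered_gaussian_def)
  have s0: "?s \<ge> 0" using C by (simp add: psd_matrix_def)
  have "has_bochner_integral ?D (\<lambda>x. x\<^sup>2) ?s \<and> has_bochner_integral ?D (\<lambda>x. x) 0"
  proof (cases "?s = 0")
    case True
    have *: "has_bochner_integral (return borel (0::real)) f 0" if "f \<in> borel_measurable borel" "f 0 = 0" for f :: "real \<Rightarrow> real"
    proof -
      have "has_bochner_integral (return borel (0::real)) f 0 \<longleftrightarrow> has_bochner_integral (return borel (0::real)) (\<lambda>x. 0 :: real) 0"
        using that by (intro has_bochner_integral_cong_AE) (simp_all add: AE_return)
      then show ?thesis using has_bochner_integral_zero by blast
    qed
    show ?thesis unfolding D using True by (auto intro!: *)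
  next
    case False
    then have pos: "0 < sqrt ?s" using s0 by simp
    have "has_bochner_integral lborel (\<lambda>x. normal_density 0 (sqrt ?s) x *\<^sub>R x\<^sup>2) ?s"
      using normal_moment_even[OF pos, of 0 1] s0 by simp
    moreover have "has_bochner_integral lborel (\<lambda>x. normal_density 0 (sqrt ?s) x *\<^sub>R x) 0"
      using normal_moment_odd[OF pos, of 0 0] by simp
    ultimately show ?thesis
      unfolding D using False by (auto intro!: has_bochner_integral_density)
  qed
  moreover have [measurable]: "(\<lambda>w. v \<bullet> w) \<in> borel_measurable W"
    by (simp add: measurable_cong_sets[OF sets refl])
  ultimately show "has_bochner_integral W (\<lambda>w. (v \<bullet> w)\<^sup>2) ?s" "has_bochner_integral W (\<lambda>w. v \<bullet> w) 0"
    by (simp_all add: has_bochner_integral_iff integrable_distr_eq integral_distr)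
qed

text \<open>Polarization: a product of two coordinates is half of the square of their sum minus
  their squares, and each square is that of a projection.\<close>

lemma centered_gaussian_moments:
  assumes W: "centered_gaussian C W" and C: "psd_matrix C"
  shows "has_bochner_integral W (\<lambda>w. w $ i * w $ j) (C $ i $ j)"
    and "has_bochner_integral W (\<lambda>w. w $ i) 0"
proof -
  let ?a = "axis i 1" and ?b = "axis j 1"
  note m = centered_gaussian_projection_moments[OF W C]
  have inner: "axis k 1 \<bullet> (w :: real^'n) = w $ k" for k w
    by (simp add: inner_axis')
  have entry: "axis k 1 \<bullet> (C *v axis l 1) = C $ k $ l" for k l
    by (simp add: inner matrix_vector_mult_basis column_def)
  have sym: "C $ j $ i = C $ i $ j"
    using C by (auto simp: psd_matrix_def transpose_def vec_eq_iff)
  have "has_bochner_integral W (\<lambda>w. (1/2) * (((?a + ?b) \<bullet> w)\<^sup>2 - (?a \<bullet> w)\<^sup>2 - (?b \<bullet> w)\<^sup>2))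
    ((1/2) * ((?a + ?b) \<bullet> (C *v (?a + ?b)) - ?a \<bullet> (C *v ?a) - ?b \<bullet> (C *v ?b)))"
    by (intro has_bochner_integral_mult_right has_bochner_integral_diff m)
  moreover have "(1/2) * (((?a + ?b) \<bullet> w)\<^sup>2 - (?a \<bullet> w)\<^sup>2 - (?b \<bullet> w)\<^sup>2) = w $ i * w $ j" for w
    by (simp add: inner_add_left inner power2_sum)
  moreover have "(1/2) * ((?a + ?b) \<bullet> (C *v (?a + ?b)) - ?a \<bullet> (C *v ?a) - ?b \<bullet> (C *v ?b)) = C $ i $ j"
    by (simp add: matrix_vector_right_distrib inner_add_left inner_add_right entry sym)
  ultimately show "has_bochner_integral W (\<lambda>w. w $ i * w $ j) (C $ i $ j)" by simp
  show "has_bochner_integral W (\<lambda>w. w $ i) 0"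
    using m(2)[of ?a] by (simp add: inner)
qed

lemma noise_sequence_moments:
  assumes W: "centered_gaussian C W" and C: "psd_matrix C"
  shows "has_bochner_integral (\<Pi>\<^sub>M i\<in>(UNIV::nat set). W) (\<lambda>w. w s $ i * w r $ j) (if s = r then C $ i $ j else 0)"
proof -
  let ?P = "\<Pi>\<^sub>M i\<in>(UNIV::nat set). W"
  have prob: "prob_space W" and sets: "sets W = sets borel" using W by (simp_all add: centered_gaussian_def)
  interpret P: prob_space ?P using prob by (intro prob_space_PiM)
  have [measurable]: "(\<lambda>x. x $ k) \<in> borel_measurable W" for k
    by (simp add: measurable_cong_sets[OF sets refl])
  have marginal: "has_bochner_integral ?P (\<lambda>w. f (w s)) x" 
    if "has_bochner_integral W f x" for f :: "_ \<Rightarrow> real" and x s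
  proof -
    have "distr ?P W (\<lambda>w. w s) = W" using prob by (intro distr_PiM_component) auto
    moreover have [measurable]: "f \<in> borel_measurable W" using that by (rule borel_measurable_has_bochner_integral)
    ultimately show ?thesis using that
      using integrable_distr_eq[of "\<lambda>w. w s" ?P W f] integral_distr[of "\<lambda>w. w s" ?P W f]
      by (simp add: has_bochner_integral_iff)
  qed
  show ?thesis
  proof (cases "s = r")
    case True
    then show ?thesis using marginal[OF centered_gaussian_moments(1)[OF W C, of i j], of s] by simp
  next
    case False
    \<comment> \<open>A single family of functions indexed by time, so that
      \<open>w s $ i * w r $ j\<close> is its product over \<open>{s, r}\<close>, the form in which
      independence factors an expectation.\<close>
    let ?Y = "\<lambda>k x. if k = s then x $ i else x $ j"
    have "distr ?P W (\<lambda>w. w k) = W" for k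
      using prob by (intro distr_PiM_component) auto
    then have "P.indep_vars (\<lambda>_. W) (\<lambda>k w. w k) UNIV"
      by (subst P.indep_vars_iff_distr_eq_PiM) (simp_all add: restrict_UNIV)
    then have "P.indep_vars (\<lambda>_. W) (\<lambda>k w. w k) {s, r}"
      by (rule P.indep_vars_subset) simp
    then have "P.indep_vars (\<lambda>_. borel) (\<lambda>k w. ?Y k (w k)) {s, r}"
      by (rule P.indep_vars_compose2) simp
    moreover have Y: "has_bochner_integral ?P (\<lambda>w. ?Y k (w k)) 0" for k
      using marginal[OF centered_gaussian_moments(2)[OF W C]] by (cases "k = s") simp_all
    ultimately have "has_bochner_integral ?P (\<lambda>w. \<Prod>k\<in>{s, r}. ?Y k (w k)) (\<Prod>k\<in>{s, r}. \<integral>w. ?Y k (w k) \<partial>?P)"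
      unfolding has_bochner_integral_iff
      by (intro conjI P.indep_vars_integrable P.indep_vars_lebesgue_integral) (auto simp: has_bochner_integral_iff)
    then show ?thesis using False has_bochner_integral_integral_eq[OF Y] by simp
  qed
qed

text \<open>Variation of constants. The noise \<open>w s\<close> first enters the state at time
  \<open>s + 1\<close>, hence the exponent \<open>t - Suc s\<close>.\<close>

lemma feedback_state_sum:
  "feedback_state S K w t = (\<Sum>s<t. mat_pow (closed_loop S K) (t - Suc s) *v w s)"
proof (induction t)
  case (Suc t)
  let ?M = "closed_loop S K"
  have "feedback_state S K w (Suc t) = ?M *v feedback_state S K w t + w t"
    by (simp add: closed_loop_def matrix_vector_mult_add_rdistrib matrix_vector_mul_assoc)
  also have "\<dots> = (\<Sum>s<t. mat_pow ?M (Suc t - Suc s) *v w s) + w t"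
    unfolding Suc linear_sum[OF matrix_vector_mul_linear]
    by (intro arg_cong2[where f="(+)"] sum.cong) (simp_all add: Suc_diff_Suc matrix_vector_mul_assoc flip: mat_pow.simps(2))
  finally show ?case by simp
qed simp

lemma stage_cost_feedback: "stage_cost Q R x (K *v x) = x \<bullet> (cost_matrix Q R K *v x)"
proof -
  have "(K *v x) \<bullet> (R *v (K *v x)) = x \<bullet> (transpose K *v (R *v (K *v x)))"
    by (simp add: inner_commute[of x] dot_lmul_matrix) (rule inner_commute)
  then show ?thesis
    by (simp add: stage_cost_def cost_matrix_def matrix_vector_mult_add_rdistrib inner_add_right
        matrix_vector_mul_assoc matrix_mul_assoc del: transpose_matrix_vector)
qed

text \<open>Expanding the state in the noise gives a double sum over times. White noise leaves only
  the diagonal, where cyclicity of the trace yields Lyapunov terms in reversed order.\<close>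

lemma expected_stage_cost:
  assumes W: "centered_gaussian C W" and C: "psd_matrix C"
  shows "(\<integral>w. stage_cost Q R (feedback_state S K w t) (K *v feedback_state S K w t) \<partial>(\<Pi>\<^sub>M i\<in>(UNIV::nat set). W))
    = (\<Sum>s<t. trace (cost_matrix Q R K ** lyapunov_term (closed_loop S K) C s))"
proof -
  let ?P = "\<Pi>\<^sub>M i\<in>(UNIV::nat set). W" and ?H = "cost_matrix Q R K"
  define N where "N s = mat_pow (closed_loop S K) (t - Suc s)" for s
  define G where "G s r = transpose (N s) ** ?H ** N r" for s r
  have quad: "stage_cost Q R (feedback_state S K w t) (K *v feedback_state S K w t)
      = (\<Sum>s<t. \<Sum>r<t. \<Sum>i\<in>UNIV. \<Sum>j\<in>UNIV. G s r $ i $ j * (w s $ i * w r $ j))" for w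
  proof -
    have bil: "(N s *v w s) \<bullet> (?H *v (N r *v w r)) = w s \<bullet> (G s r *v w r)" for s r
      by (simp add: G_def dot_lmul_matrix matrix_vector_mul_assoc[symmetric] inner_commute[of "N s *v w s"] inner_commute[of "w s"])
    have "stage_cost Q R (feedback_state S K w t) (K *v feedback_state S K w t)
        = (\<Sum>s<t. N s *v w s) \<bullet> (?H *v (\<Sum>r<t. N r *v w r))"
      unfolding stage_cost_feedback feedback_state_sum N_def ..
    also have "\<dots> = (\<Sum>s<t. \<Sum>r<t. w s \<bullet> (G s r *v w r))"
      by (simp add: linear_sum[OF matrix_vector_mul_linear] inner_sum_left inner_sum_right bil)
        (rule sum.swap)
    finally show ?thesis
      by (simp add: inner_vec_def matrix_vector_mult_def sum_distrib_left mult_ac)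
  qed
  have "has_bochner_integral ?P
      (\<lambda>w. stage_cost Q R (feedback_state S K w t) (K *v feedback_state S K w t))
      (\<Sum>s<t. \<Sum>r<t. \<Sum>i\<in>UNIV. \<Sum>j\<in>UNIV. G s r $ i $ j * (if s = r then C $ i $ j else 0))"
    unfolding quad
    by (intro has_bochner_integral_sum has_bochner_integral_mult_right noise_sequence_moments[OF W C])
  then have "(\<integral>w. stage_cost Q R (feedback_state S K w t) (K *v feedback_state S K w t) \<partial>?P)
      = (\<Sum>s<t. \<Sum>r<t. \<Sum>i\<in>UNIV. \<Sum>j\<in>UNIV. G s r $ i $ j * (if s = r then C $ i $ j else 0))"
    by (rule has_bochner_integral_integral_eq)
  also have "\<dots> = (\<Sum>s<t. \<Sum>r<t. if r = s then (\<Sum>i\<in>UNIV. \<Sum>j\<in>UNIV. G s s $ i $ j * C $ i $ j) else 0)"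
    by (intro sum.cong refl) auto
  also have "\<dots> = (\<Sum>s<t. \<Sum>i\<in>UNIV. \<Sum>j\<in>UNIV. G s s $ i $ j * C $ i $ j)"
    by simp
  also have "\<dots> = (\<Sum>s<t. trace (?H ** lyapunov_term (closed_loop S K) C (t - Suc s)))"
  proof (intro sum.cong refl)
    fix s
    have C': "transpose C = C" using C by (simp add: psd_matrix_def)
    have "(\<Sum>i\<in>UNIV. \<Sum>j\<in>UNIV. G s s $ i $ j * C $ i $ j) = C \<bullet> G s s"
      by (simp add: inner_vec_def mult.commute)
    also have "\<dots> = trace (G s s ** C)"
      by (simp add: inner_eq_trace C' trace_mul_sym[of C])
    also have "\<dots> = trace (transpose (N s) ** (?H ** N s ** C))" by (simp add: G_def matrix_mul_assoc)
    also have "\<dots> = trace (?H ** N s ** C ** transpose (N s))" by (rule trace_mul_sym)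
    finally show "(\<Sum>i\<in>UNIV. \<Sum>j\<in>UNIV. G s s $ i $ j * C $ i $ j)
        = trace (?H ** lyapunov_term (closed_loop S K) C (t - Suc s))"
      by (simp add: lyapunov_term_def N_def matrix_mul_assoc)
  qed
  also have "\<dots> = (\<Sum>s<t. trace (?H ** lyapunov_term (closed_loop S K) C s))"
    by (rule sum.nat_diff_reindex)
  finally show ?thesis .
qed

text \<open>The expected stage costs are the partial sums of a convergent series, so their Cesaro
  means converge to its sum and the \<open>limsup\<close> is a limit.\<close>

lemma lqr_cost_eq:
  assumes W: "centered_gaussian C W" and C: "psd_matrix C"
    and q: "0 < q" "q < 1" "geometric_powers c q (closed_loop S K)"
  shows "lqr_cost Q R W S K = ereal (trace (cost_matrix Q R K ** state_covariance C S K))"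
proof -
  let ?H = "cost_matrix Q R K" and ?M = "closed_loop S K"
  have "bounded_linear (\<lambda>X. trace (?H ** X))"
    unfolding linear_conv_bounded_linear[symmetric]
    by (auto intro!: linearI simp: matrix_mult_distribs trace_add matrix_scalar_ac scalar_matrix_assoc[symmetric])
      (simp add: trace_def sum_distrib_left)
  then have "(\<lambda>s. trace (?H ** lyapunov_term ?M C s)) sums trace (?H ** lyapunov_sum ?M C)"
    unfolding lyapunov_sum_def using summable_sums[OF summable_lyapunov_term[OF q]]
    by (rule bounded_linear.sums)
  then have "(\<lambda>t. \<Sum>s<t. trace (?H ** lyapunov_term ?M C s)) \<longlonglongrightarrow> trace (?H ** lyapunov_sum ?M C)"
    by (simp add: sums_def)
  then have "(\<lambda>T. ereal (1 / real T * (\<Sum>t<T. \<Sum>s<t. trace (?H ** lyapunov_term ?M C s))))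
      \<longlonglongrightarrow> ereal (trace (?H ** lyapunov_sum ?M C))"
    by (intro tendsto_ereal cesaro_mean_tendsto)
  then show ?thesis
    unfolding lqr_cost_def expected_stage_cost[OF W C] state_covariance_eq
    by (rule lim_imp_Limsup[OF sequentially_bot])
qed

theorem policy_gradient_eq:
  fixes A :: "real^'x^'x" and B :: "real^'u^'x"
  assumes Q: "psd_matrix Q" and R: "psd_matrix R" and C: "psd_matrix C"
    and W: "centered_gaussian C W" and st: "stabilizing (A, B) K"
  shows "policy_gradient Q R W (A, B) K
    = 2 *\<^sub>R ((R ** K + transpose B ** value_matrix Q R (A, B) K ** (A + B ** K)) ** state_covariance C (A, B) K)"
  unfolding policy_gradient_def
proof (rule the_equality)
  show "GDERIV (\<lambda>K'. real_of_ereal (lqr_cost Q R W (A, B) K')) K :>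
      2 *\<^sub>R ((R ** K + transpose B ** value_matrix Q R (A, B) K ** (A + B ** K)) ** state_covariance C (A, B) K)"
    using Q R C st by (intro GDERIV_lqr) (auto simp: psd_matrix_def stabilizing_def lqr_cost_eq[OF W C])
  then show "G = 2 *\<^sub>R ((R ** K + transpose B ** value_matrix Q R (A, B) K ** (A + B ** K)) ** state_covariance C (A, B) K)"
    if "GDERIV (\<lambda>K'. real_of_ereal (lqr_cost Q R W (A, B) K')) K :> G" for G
    using that GDERIV_unique by blast
qed

section \<open>The law of the data\<close>

lemma borel_measurable_matrix_vector_mult:
  fixes M :: "real^'m^'n"
  assumes "f \<in> borel_measurable N"
  shows "(\<lambda>x. M *v f x) \<in> borel_measurable N"
  using assms
  by (rule borel_measurable_continuous_on[rotated])
    (intro linear_continuous_on linear_conv_bounded_linear[THEN iffD1] matrix_vector_mul_linear)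

lemma run_state_Suc:
  "run_state T U S r w (n, Suc t)
    = fst S *v run_state T U S r w (n, t) + snd S *v run_input T U S r w (n, t) + w (n, t)"
  by (simp add: run_input_def restrict_def)

context
  fixes N T :: nat and W :: "(real^'x) measure" and Z :: "'r measure"
    and U :: "('x::finite, 'u::finite, 'r) input_rule" and S :: "('x, 'u) system"
  assumes sets_W: "sets W = sets borel" and rule: "measurable_rule N T Z U"
begin

abbreviation (input) "noise \<equiv> Z \<Otimes>\<^sub>M (\<Pi>\<^sub>M p\<in>input_index N T. W)"

lemma measurable_run_input:
  assumes "(n, t) \<in> input_index N T"
    and "\<And>p. p \<in> past T n t \<Longrightarrow> (\<lambda>(r, w). run_state T U S r w p) \<in> borel_measurable noise"
  shows "(\<lambda>(r, w). run_input T U S r w (n, t)) \<in> borel_measurable noise"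
proof -
  have U: "(\<lambda>(h, r). U n t h r) \<in> borel_measurable ((\<Pi>\<^sub>M p\<in>past T n t. borel) \<Otimes>\<^sub>M Z)"
    using rule assms(1) by (auto simp: measurable_rule_def)
  have "(\<lambda>x. restrict (run_state T U S (fst x) (snd x)) (past T n t)) \<in> noise \<rightarrow>\<^sub>M (\<Pi>\<^sub>M p\<in>past T n t. borel)"
    using assms(2) by (intro measurable_restrict) (simp add: case_prod_beta')
  then have "(\<lambda>x. (restrict (run_state T U S (fst x) (snd x)) (past T n t), fst x))
      \<in> noise \<rightarrow>\<^sub>M ((\<Pi>\<^sub>M p\<in>past T n t. borel) \<Otimes>\<^sub>M Z)"
    by (intro measurable_Pair measurable_fst)
  from measurable_compose[OF this U] show ?thesis
    by (simp add: run_input_def case_prod_beta')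
qed

text \<open>The nested induction, over runs and then over times, follows the information available
  to an input: all of the earlier runs, and the current run so far.\<close>

lemma measurable_run_state:
  assumes "p \<in> state_index N T"
  shows "(\<lambda>(r, w). run_state T U S r w p) \<in> borel_measurable noise"
proof -
  have "1 \<le> n \<Longrightarrow> n \<le> N \<Longrightarrow> t \<le> T \<Longrightarrow> (\<lambda>(r, w). run_state T U S r w (n, t)) \<in> borel_measurable noise" for n t
  proof (induction n arbitrary: t rule: less_induct)
    case (less n)
    note outer_IH = less.IH and outer_prems = less.prems
    from less.prems(3) show ?case
    proof (induction t rule: less_induct)
      case (less t)
      show ?case
      proof (cases t)
        case 0
        then show ?thesis by (simp add: case_prod_beta')
      next
        case (Suc s)
        have idx: "(n, s) \<in> input_index N T" using outer_prems less.prems Suc by (auto simp: input_index_def)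
        have st: "(\<lambda>(r, w). run_state T U S r w (n, s)) \<in> borel_measurable noise"
          using less Suc by simp
        have inp: "(\<lambda>(r, w). run_input T U S r w (n, s)) \<in> borel_measurable noise"
        proof (rule measurable_run_input[OF idx])
          fix p assume "p \<in> past T n s"
          then show "(\<lambda>(r, w). run_state T U S r w p) \<in> borel_measurable noise"
            using outer_IH[of "fst p" "snd p"] less.IH[of "snd p"] outer_prems less.prems Suc
            by (cases p) (auto simp: past_def)
        qed
        have "(\<lambda>(r, w). w (n, s)) \<in> noise \<rightarrow>\<^sub>M W"
          using idx by (auto simp: case_prod_beta' intro!: measurable_compose[OF measurable_snd] measurable_component_singleton)
        then have noise: "(\<lambda>(r, w). w (n, s)) \<in> borel_measurable noise"
          by (simp add: measurable_cong_sets[OF refl sets_W])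
        show ?thesis
          using st inp noise unfolding Suc run_state_Suc case_prod_beta'
          by (intro borel_measurable_add borel_measurable_matrix_vector_mult)
      qed
    qed
  qed
  with assms show ?thesis by (auto simp: state_index_def)
qed

lemma measurable_experiment:
  "(\<lambda>(r, w). (restrict (run_state T U S r w) (state_index N T), restrict (run_input T U S r w) (input_index N T)))
    \<in> noise \<rightarrow>\<^sub>M data_space N T"
proof -
  have "(\<lambda>(r, w). run_input T U S r w (n, t)) \<in> borel_measurable noise" if "(n, t) \<in> input_index N T" for n t
    using that by (intro measurable_run_input measurable_run_state) (auto simp: input_index_def state_index_def past_def)
  then have "(\<lambda>x. (restrict (run_state T U S (fst x) (snd x)) (state_index N T),
      restrict (run_input T U S (fst x) (snd x)) (input_index N T))) \<in> noise \<rightarrow>\<^sub>M data_space N T"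
    using measurable_run_state unfolding data_space_def
    by (intro measurable_Pair measurable_restrict) (auto simp: case_prod_beta')
  then show ?thesis by (simp add: case_prod_beta')
qed

lemma prob_space_data_law:
  assumes "prob_space W" "prob_space Z"
  shows "prob_space (data_law N T W Z U S)"
proof -
  interpret pair_prob_space Z "\<Pi>\<^sub>M p\<in>input_index N T. W"
    using assms by (simp add: pair_prob_space_def pair_sigma_finite_def prob_space_PiM prob_space_imp_sigma_finite)
  show ?thesis
    unfolding data_law_def by (rule prob_space_distr[OF measurable_experiment])
qed

end

lemma sets_data_law [simp]: "sets (data_law N T W Z U S) = sets (data_space N T)"
  by (simp add: data_law_def)

section \<open>Pinsker's inequality and the two-point bound\<close>

text \<open>The weight \<open>(2 * x + 4) / 3\<close> equals 2 at \<open>x = 1\<close> and, being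
  affine, has mean 2 under any density with respect to a probability measure. This produces the
  constant in Pinsker's inequality.\<close>

lemma pinsker_pointwise:
  fixes x :: real
  assumes "0 \<le> x"
  shows "(x - 1)\<^sup>2 \<le> (2 * x + 4) / 3 * (x * ln x - x + 1)"
proof (cases "x = 0")
  case False
  with assms have x: "0 < x" by simp
  \<comment> \<open>\<open>k\<close> is the derivative of \<open>h\<close> and is increasing with
    zero 1; thus \<open>h\<close> decreases up to 1, increases afterwards, and has minimum
    \<open>h 1 = 0\<close>.\<close>
  define k where "k y = ln y - 3 / 2 + 27 / (2 * (y + 2)\<^sup>2)" for y :: real
  define h where "h y = y * ln y - y + 1 - 3 * (y - 1)\<^sup>2 / (2 * y + 4)" for y :: real
  have dk: "(k has_real_derivative (y - 1)\<^sup>2 * (y + 8) / (y * (y + 2) ^ 3)) (at y)" if "0 < y" for y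
    unfolding k_def using that
    by (auto intro!: derivative_eq_intros) (simp add: divide_simps, simp add: power2_eq_square power3_eq_cube power4_eq_xxxx algebra_simps)
  have dh: "(h has_real_derivative k y) (at y)" if "0 < y" for y
    unfolding h_def k_def using that
    by (auto intro!: derivative_eq_intros)
      (simp add: divide_simps, simp add: power2_eq_square power3_eq_cube power4_eq_xxxx algebra_simps)
  have k1: "k 1 = 0" and h1: "h 1 = 0" by (simp_all add: k_def h_def)
  have k_mono: "k a \<le> k b" if "0 < a" "a \<le> b" for a b
  proof (rule DERIV_nonneg_imp_nondecreasing[OF that(2)])
    fix y assume "a \<le> y" "y \<le> b"
    then show "\<exists>z. (k has_real_derivative z) (at y) \<and> 0 \<le> z"
      using dk[of y] that by (intro exI conjI) auto
  qed
  have "h 1 \<le> h x"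
  proof (cases "x \<le> 1")
    case True
    then show ?thesis
    proof (rule DERIV_nonpos_imp_nonincreasing)
      fix y assume "x \<le> y" "y \<le> 1"
      then show "\<exists>z. (h has_real_derivative z) (at y) \<and> z \<le> 0"
        using dh[of y] k_mono[of y 1] k1 x by (intro exI conjI) auto
    qed
  next
    case False
    then have "1 \<le> x" by simp
    then show ?thesis
    proof (rule DERIV_nonneg_imp_nondecreasing)
      fix y assume "1 \<le> y" "y \<le> x"
      then show "\<exists>z. (h has_real_derivative z) (at y) \<and> 0 \<le> z"
        using dh[of y] k_mono[of 1 y] k1 by (intro exI conjI) auto
    qed
  qed
  then have "3 * (x - 1)\<^sup>2 / (2 * x + 4) \<le> x * ln x - x + 1" by (simp add: h1) (simp add: h_def)
  moreover have "0 < 2 * x + 4" using x by simp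
  ultimately have "3 * (x - 1)\<^sup>2 \<le> (x * ln x - x + 1) * (2 * x + 4)"
    by (simp only: pos_divide_le_eq)
  moreover have "(2 * x + 4) / 3 * (x * ln x - x + 1) = (x * ln x - x + 1) * (2 * x + 4) / 3" by simp
  ultimately show ?thesis by linarith
qed simp

text \<open>
  Integrating this and optimizing over \<open>a\<close> replaces the use of the Cauchy-Schwarz inequality in the
  proof of Pinsker's inequality.
\<close>

lemma pinsker_young:
  fixes x a :: real
  assumes x: "0 \<le> x" and a: "0 < a"
  shows "2 * \<bar>x - 1\<bar> \<le> a * ((2 * x + 4) / 3) + (x * ln x - x + 1) / a"
proof -
  let ?u = "(2 * x + 4) / 3" and ?h = "x * ln x - x + 1"
  have u: "0 < ?u" using x by simp
  have "0 \<le> ?u * ?h" using pinsker_pointwise[OF x] zero_le_power2[of "x - 1"] by linarith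
  then have h: "0 \<le> ?h" using u by (simp only: zero_le_mult_iff) linarith
  have "(2 * \<bar>x - 1\<bar>)\<^sup>2 = 4 * (x - 1)\<^sup>2" by (simp add: power_mult_distrib)
  also have "\<dots> \<le> 4 * (?u * ?h)" using pinsker_pointwise[OF x] by linarith
  also have "\<dots> \<le> (a * ?u + ?h / a)\<^sup>2"
  proof -
    have amgm: "4 * (p * r) \<le> (p + r)\<^sup>2" for p r :: real
      using zero_le_power2[of "p - r"] by (simp add: power2_sum power2_diff)
    have "?u * ?h = (a * ?u) * (?h / a)" using a by simp
    then show ?thesis using amgm[of "a * ?u" "?h / a"] by (simp only:)
  qed
  finally show ?thesis
    by (rule power2_le_imp_le) (use a u h in simp)
qed

lemma (in prob_space) pinsker_density:
  fixes f :: "'a \<Rightarrow> real"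
  assumes f: "\<And>x. x \<in> space M \<Longrightarrow> 0 \<le> f x" "integrable M f" "(\<integral>x. f x \<partial>M) = 1"
    and int: "integrable M (\<lambda>x. f x * ln (f x))"
  defines "\<kappa> \<equiv> (\<integral>x. f x * ln (f x) \<partial>M)"
  shows "0 \<le> \<kappa>" "(\<integral>x. \<bar>f x - 1\<bar> \<partial>M) \<le> 2 * sqrt (\<kappa> / 2)"
proof -
  let ?I = "\<integral>x. \<bar>f x - 1\<bar> \<partial>M"
  have bound: "2 * ?I \<le> 2 * a + \<kappa> / a" if a: "0 < a" for a
  proof -
    have "2 * ?I = (\<integral>x. 2 * \<bar>f x - 1\<bar> \<partial>M)" by simp
    also have "\<dots> \<le> (\<integral>x. a * ((2 * f x + 4) / 3) + (f x * ln (f x) - f x + 1) / a \<partial>M)"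
      using f int a by (intro integral_mono pinsker_young) auto
    also have "\<dots> = a * ((2 * (\<integral>x. f x \<partial>M) + 4) / 3) + (\<kappa> - (\<integral>x. f x \<partial>M) + 1) / a"
      unfolding \<kappa>_def using f(2) int by (simp add: prob_space)
    finally show ?thesis by (simp add: f(3))
  qed
  have I: "0 \<le> ?I" by simp
  show \<kappa>: "0 \<le> \<kappa>"
  proof (rule ccontr)
    assume neg: "\<not> 0 \<le> \<kappa>"
    \<comment> \<open>This choice gives \<open>\<kappa> / a = - 4 * a\<close>, so the upper bound is
      \<open>- 2 * a < 0\<close>, impossible for an integral of absolute values.\<close>
    define a where "a = sqrt (- \<kappa> / 4)"
    have a: "0 < a" "\<kappa> = - 4 * a\<^sup>2" using neg by (simp_all add: a_def)
    have "2 * a + \<kappa> / a = - 2 * a" using a by (simp add: power2_eq_square)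
    with bound[OF a(1)] I a(1) show False by linarith
  qed
  show "?I \<le> 2 * sqrt (\<kappa> / 2)"
  proof (cases "\<kappa> = 0")
    case True
    \<comment> \<open>The infimum over \<open>a\<close> is not attained here; it is reached by
      letting \<open>a\<close> tend to 0.\<close>
    have "?I \<le> 0 + a" if "0 < a" for a using bound[OF that] True by simp
    then have "?I \<le> 0" by (rule field_le_epsilon)
    then show ?thesis using True by simp
  next
    case False
    \<comment> \<open>The minimizer of \<open>2 * a + \<kappa> / a\<close>, at which both summands
      are equal.\<close>
    define a where "a = sqrt (\<kappa> / 2)"
    have a: "0 < a" "\<kappa> = 2 * a\<^sup>2" using False \<kappa> by (simp_all add: a_def)
    then have "2 * a + \<kappa> / a = 4 * a" by (simp add: power2_eq_square)
    then show ?thesis using bound[OF a(1)] by (simp add: a_def)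
  qed
qed

text \<open>With \<open>D\<close> the density of \<open>P1\<close> with respect to
  \<open>P2\<close>, the function \<open>min D 1\<close> lies below the \<open>P2\<close>-densities
  of both laws. On this common part both losses are charged, and together they cost at least
  \<open>c\<close>; its mass is one minus the total variation distance.\<close>

lemma two_point_lower_bound:
  fixes \<phi> \<psi> :: "'a \<Rightarrow> ennreal"
  assumes P: "prob_space P1" "prob_space P2" and sets: "sets P1 = sets P2"
    and ac: "absolutely_continuous P2 P1" and int: "integrable P1 (entropy_density (exp 1) P2 P1)"
    and meas: "\<phi> \<in> borel_measurable P2" "\<psi> \<in> borel_measurable P2"
    and sep: "\<And>x. x \<in> space P2 \<Longrightarrow> ennreal c \<le> \<phi> x + \<psi> x" and c: "0 \<le> c"
  shows "ennreal (c * (1 - sqrt (KL_divergence (exp 1) P2 P1 / 2))) \<le> (\<integral>\<^sup>+ x. \<phi> x \<partial>P1) + (\<integral>\<^sup>+ x. \<psi> x \<partial>P2)"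
proof -
  interpret P1: prob_space P1 by fact
  interpret P2: prob_space P2 by fact
  note [measurable] = meas
  obtain D where D: "D \<in> borel_measurable P2" "AE x in P2. RN_deriv P2 P1 x = ennreal (D x)" "\<And>x. 0 \<le> D x"
    using P2.real_RN_deriv[OF P1.finite_measure_axioms ac sets] by blast
  note [measurable] = D(1)
  have P1: "P1 = density P2 D"
    using P2.density_RN_deriv[OF ac sets] D by (subst (asm) density_cong[of _ _ D]) auto
  have nn: "(\<integral>\<^sup>+ x. ennreal (D x) \<partial>P2) = 1"
    using P1.emeasure_space_1 unfolding P1 by (subst (asm) emeasure_density) (auto simp: indicator_def cong: nn_integral_cong)
  then have intD: "integrable P2 D" and D1: "(\<integral>x. D x \<partial>P2) = 1"
    using D(3) by (auto simp: integrable_iff_bounded integral_eq_nn_integral)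
  have e: "AE x in P2. entropy_density (exp 1) P2 P1 x = ln (D x)"
    using D(2) by eventually_elim (simp add: entropy_density_def log_def D(3))
  have "integrable P2 (\<lambda>x. D x * entropy_density (exp 1) P2 P1 x)"
    using int D(3) by (subst (asm) (1) P1) (simp add: integrable_real_density)
  then have intL: "integrable P2 (\<lambda>x. D x * ln (D x))"
    by (rule integrable_cong_AE_imp) (use e in \<open>auto elim: eventually_mono\<close>)
  have KL: "KL_divergence (exp 1) P2 P1 = (\<integral>x. D x * ln (D x) \<partial>P2)"
    unfolding P1 by (subst P2.KL_density) (auto simp: D(3) log_def)
  let ?m = "\<lambda>x. min (D x) 1"
  \<comment> \<open>This turns the overlap into one minus half the \<open>L1\<close> distance, to
    which Pinsker's inequality applies.\<close>
  have m: "?m x = (D x + 1 - \<bar>D x - 1\<bar>) / 2" for x by (simp add: min_def abs_if)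
  have intm: "integrable P2 ?m" unfolding m using intD by auto
  have "1 - sqrt (KL_divergence (exp 1) P2 P1 / 2) \<le> (\<integral>x. ?m x \<partial>P2)"
    unfolding m using P2.pinsker_density(2)[OF D(3) intD D1 intL] intD by (simp add: KL D1 P2.prob_space)
  then have "ennreal (c * (1 - sqrt (KL_divergence (exp 1) P2 P1 / 2))) \<le> ennreal (\<integral>x. c * ?m x \<partial>P2)"
    using c by (intro ennreal_leI) (simp add: mult_left_mono)
  also have "\<dots> = (\<integral>\<^sup>+ x. ennreal (c * ?m x) \<partial>P2)"
    using c D(3) intm by (intro nn_integral_eq_integral[symmetric]) auto
  also have "\<dots> \<le> (\<integral>\<^sup>+ x. ennreal (D x) * \<phi> x + \<psi> x \<partial>P2)"
  proof (rule nn_integral_mono)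
    fix x assume "x \<in> space P2"
    have "ennreal (c * ?m x) = ennreal (?m x) * ennreal c"
      using c D(3) by (simp add: ennreal_mult mult.commute)
    also have "\<dots> \<le> ennreal (?m x) * (\<phi> x + \<psi> x)"
      using sep[OF \<open>x \<in> space P2\<close>] by (rule mult_left_mono) simp
    also have "\<dots> = ennreal (?m x) * \<phi> x + ennreal (?m x) * \<psi> x" by (rule distrib_left)
    also have "\<dots> \<le> ennreal (D x) * \<phi> x + 1 * \<psi> x"
      by (intro add_mono mult_right_mono) (auto intro: ennreal_leI simp flip: ennreal_1)
    finally show "ennreal (c * ?m x) \<le> ennreal (D x) * \<phi> x + \<psi> x" by simp
  qed
  also have "\<dots> = (\<integral>\<^sup>+ x. \<phi> x \<partial>P1) + (\<integral>\<^sup>+ x. \<psi> x \<partial>P2)"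
    unfolding P1 by (simp add: nn_integral_add nn_integral_density)
  finally show ?thesis .
qed

section \<open>The operator norm and the perturbed system\<close>

lemma op_norm_nonneg: "0 \<le> op_norm M"
  unfolding op_norm_def by (rule onorm_pos_le[OF matrix_vector_mul_bounded_linear])

lemma op_norm_add_le: "op_norm (M + N) \<le> op_norm M + op_norm N"
  using onorm_triangle[OF matrix_vector_mul_bounded_linear[of M] matrix_vector_mul_bounded_linear[of N]]
  by (simp add: op_norm_def flip: matrix_vector_mult_add_rdistrib)

lemma op_norm_scaleR: "op_norm (c *\<^sub>R M) = \<bar>c\<bar> * op_norm M"
  using onorm_scaleR[OF matrix_vector_mul_bounded_linear[of M], of c]
  by (simp add: op_norm_def scaleR_matrix_vector_assoc)

text \<open>With \<open>X\<close> an estimate: it cannot be close to both gradients at once.\<close>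

lemma op_norm_diff_triangle: "op_norm (G - H) \<le> op_norm (G - X) + op_norm (H - X)"
proof -
  have "op_norm (G - H) \<le> op_norm (G - X) + op_norm (X - H)"
    using op_norm_add_le[of "G - X" "X - H"] by simp
  also have "op_norm (X - H) = op_norm (H - X)"
    using op_norm_scaleR[of "-1" "H - X"] by simp
  finally show ?thesis .
qed

lemma op_norm_le_norm: "op_norm M \<le> norm M"
  unfolding op_norm_def
proof (rule onorm_le)
  fix x
  have "(norm (M *v x))\<^sup>2 = (\<Sum>i\<in>UNIV. (M $ i \<bullet> x)\<^sup>2)"
    unfolding power2_norm_eq_inner inner_vec_def[of "M *v x"]
    by (simp add: matrix_vector_mul_component power2_eq_square)
  also have "\<dots> \<le> (\<Sum>i\<in>UNIV. (norm (M $ i))\<^sup>2 * (norm x)\<^sup>2)"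
    by (intro sum_mono) (simp add: Cauchy_Schwarz_ineq power2_norm_eq_inner)
  also have "\<dots> = (norm M * norm x)\<^sup>2"
    by (simp add: power_mult_distrib power2_norm_eq_inner inner_vec_def[of M] flip: sum_distrib_right)
  finally show "norm (M *v x) \<le> norm M * norm x" by (rule power2_le_imp_le) simp
qed

text \<open>The operator norm is dominated by the Frobenius norm, hence Lipschitz. Continuity serves
  to make the loss a Borel function of the data.\<close>

lemma continuous_on_op_norm: "continuous_on UNIV (op_norm :: real^'m^'n \<Rightarrow> real)"
proof (rule lipschitz_on_continuous_on[of 1])
  show "1-lipschitz_on UNIV (op_norm :: real^'m^'n \<Rightarrow> real)"
  proof (rule lipschitz_onI)
    fix M N :: "real^'m^'n"
    have "op_norm M \<le> op_norm N + norm (M - N)" for M N :: "real^'m^'n"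
      using op_norm_add_le[of N "M - N"] op_norm_le_norm[of "M - N"] by simp
    from this[of M N] this[of N M] show "dist (op_norm M) (op_norm N) \<le> 1 * dist M N"
      by (simp add: dist_norm norm_minus_commute abs_le_iff)
  qed simp
qed

lemma policy_gradient_perturbed_diff:
  fixes A :: "real^'x^'x" and B :: "real^'u^'x"
  assumes "psd_matrix Q" "psd_matrix R" "psd_matrix C" "centered_gaussian C W" "stabilizing (A, B) K"
  shows "stabilizing (perturbed_system (A, B) K \<Delta>) K"
    and "policy_gradient Q R W (perturbed_system (A, B) K \<Delta>) K - policy_gradient Q R W (A, B) K
      = 2 *\<^sub>R (transpose \<Delta> ** value_matrix Q R (A, B) K ** (A + B ** K) ** state_covariance C (A, B) K)"
proof -
  let ?A = "A - \<Delta> ** K" and ?B = "B + \<Delta>"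
  have S: "perturbed_system (A, B) K \<Delta> = (?A, ?B)" by (simp add: perturbed_system_def)
  have cl: "?A + ?B ** K = A + B ** K" by (simp add: matrix_mult_distribs)
  then have cl': "closed_loop (?A, ?B) K = closed_loop (A, B) K" by (simp add: closed_loop_def)
  have P: "value_matrix Q R (?A, ?B) K = value_matrix Q R (A, B) K"
    by (simp add: value_matrix_def cl')
  have G: "state_covariance C (?A, ?B) K = state_covariance C (A, B) K"
    by (simp add: state_covariance_def cl')
  show st: "stabilizing (perturbed_system (A, B) K \<Delta>) K"
    using assms(5) by (simp add: S stabilizing_def cl')
  show "policy_gradient Q R W (perturbed_system (A, B) K \<Delta>) K - policy_gradient Q R W (A, B) K
      = 2 *\<^sub>R (transpose \<Delta> ** value_matrix Q R (A, B) K ** (A + B ** K) ** state_covariance C (A, B) K)"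
    unfolding S policy_gradient_eq[OF assms(1-4) st[unfolded S]] policy_gradient_eq[OF assms] P G cl
    by (simp add: transpose_add matrix_mult_distribs scaleR_add_right)
qed

theorem theorem1:
  fixes A :: "real^'x^'x" and B :: "real^'u^'x"
    and Q :: "real^'x^'x" and R :: "real^'u^'u" and \<Sigma>W :: "real^'x^'x"
    and W :: "(real^'x) measure"
    and N T :: nat and \<beta> \<epsilon> :: real
    and Z :: "'r measure" and U :: "('x, 'u, 'r) input_rule"
    and d :: "('x, 'u) system \<Rightarrow> ('x, 'u) system \<Rightarrow> real"
    and Kstar :: "real^'x^'u"
  assumes "psd_matrix Q" and "psd_matrix R" and "psd_matrix \<Sigma>W"
    and "centered_gaussian \<Sigma>W W"
    and "(A, B) \<in> stabilizable_systems"
    and "optimal_gain Q R W (A, B) Kstar"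
    and "prob_space Z" and "measurable_rule N T Z U"
    and "\<beta> > 0" and "input_energy N T W Z U (A, B) \<le> ennreal (\<beta> * real N * real T)"
    and "Metric_space stabilizable_systems d" and "\<epsilon> > 0"
  shows "enn2ereal (local_minimax Q R N T W Z U d \<epsilon> (A, B) Kstar) \<ge>
    (SUP \<Delta> \<in> {\<Delta>. d (A, B) (perturbed_system (A, B) Kstar \<Delta>) \<le> \<epsilon>}.
       ereal (op_norm (transpose \<Delta> ** value_matrix Q R (A, B) Kstar
                 ** (A + B ** Kstar) ** state_covariance \<Sigma>W (A, B) Kstar))
       * (1 - sqrt_ereal (1 / 2 * system_kl N T W Z U (A, B) (perturbed_system (A, B) Kstar \<Delta>))))"
proof (rule SUP_least)
  fix \<Delta> assume "\<Delta> \<in> {\<Delta>. d (A, B) (perturbed_system (A, B) Kstar \<Delta>) \<le> \<epsilon>}"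
  then have d2: "d (A, B) (perturbed_system (A, B) Kstar \<Delta>) \<le> \<epsilon>" by simp
  let ?S2 = "perturbed_system (A, B) Kstar \<Delta>"
  let ?P1 = "data_law N T W Z U (A, B)" and ?P2 = "data_law N T W Z U ?S2"
  let ?X = "transpose \<Delta> ** value_matrix Q R (A, B) Kstar ** (A + B ** Kstar) ** state_covariance \<Sigma>W (A, B) Kstar"
  let ?M = "local_minimax Q R N T W Z U d \<epsilon> (A, B) Kstar"
  have stab: "stabilizing (A, B) Kstar" using assms(6) by (simp add: optimal_gain_def)
  note pert = policy_gradient_perturbed_diff[OF assms(1-4) stab, of \<Delta>]
  \<comment> \<open>The unperturbed system must itself compete in the supremum, being one of the two
    hypotheses.\<close>
  have d1: "d (A, B) (A, B) \<le> \<epsilon>"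
    using Metric_space.mdist_zero[OF assms(11)] assms(5,12) by simp
  have S2: "?S2 \<in> stabilizable_systems" using pert(1) by (auto simp: stabilizable_systems_def)
  have W: "prob_space W" "sets W = sets borel" using assms(4) by (simp_all add: centered_gaussian_def)
  have prob: "prob_space (data_law N T W Z U S)" for S
    using prob_space_data_law[OF W(2) assms(8) W(1) assms(7)] .
  show "ereal (op_norm ?X) * (1 - sqrt_ereal (1 / 2 * system_kl N T W Z U (A, B) ?S2)) \<le> enn2ereal ?M"
  proof (cases "absolutely_continuous ?P2 ?P1 \<and> integrable ?P1 (entropy_density (exp 1) ?P2 ?P1)")
    case False
    \<comment> \<open>For infinite divergence the right-hand side is \<open>-\<infinity>\<close>, or
      0 if the operator norm vanishes, while the complexity is nonnegative.\<close>
    then have "sqrt_ereal (1 / 2 * system_kl N T W Z U (A, B) ?S2) = \<infinity>"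
      by (auto simp: system_kl_def kl_div_def sqrt_ereal_def)
    then have "ereal (op_norm ?X) * (1 - sqrt_ereal (1 / 2 * system_kl N T W Z U (A, B) ?S2)) \<le> 0"
      using op_norm_nonneg[of ?X] by (simp add: ereal_mult_le_0_iff one_ereal_def)
    also have "0 \<le> enn2ereal ?M" by simp
    finally show ?thesis .
  next
    case True
    define \<kappa> where "\<kappa> = KL_divergence (exp 1) ?P2 ?P1"
    have "system_kl N T W Z U (A, B) ?S2 = ereal \<kappa>"
      using True by (simp add: system_kl_def kl_div_def \<kappa>_def)
    then have kl: "ereal (op_norm ?X) * (1 - sqrt_ereal (1 / 2 * system_kl N T W Z U (A, B) ?S2))
        = ereal (op_norm ?X * (1 - sqrt (\<kappa> / 2)))"
      by (simp add: sqrt_ereal_def one_ereal_def)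
    have "ennreal (op_norm ?X * (1 - sqrt (\<kappa> / 2))) \<le> ?M"
      unfolding local_minimax_def
    proof (rule INF_greatest)
      fix g :: "('x, 'u) data \<Rightarrow> real^'x^'u" assume g [measurable]: "g \<in> borel_measurable (data_space N T)"
      let ?L = "estimation_loss Q R N T W Z U Kstar g"
      let ?sup = "SUP S' \<in> {S' \<in> stabilizable_systems. d (A, B) S' \<le> \<epsilon>}. ?L S'"
      let ?err = "\<lambda>S D. ennreal (op_norm (policy_gradient Q R W S Kstar - g D))"
      have [measurable]: "op_norm \<in> borel_measurable borel"
        by (rule borel_measurable_continuous_onI[OF continuous_on_op_norm])
      have err: "?err S \<in> borel_measurable ?P2" for S
        by (simp add: measurable_cong_sets[OF sets_data_law refl])
      \<comment> \<open>This 2 will cancel against the two copies of \<open>?sup\<close> that bound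
        the sum of the risks.\<close>
      have "2 * op_norm ?X = op_norm (policy_gradient Q R W (A, B) Kstar - policy_gradient Q R W ?S2 Kstar)"
        using op_norm_scaleR[of "-2" ?X] pert(2) by (simp add: algebra_simps)
      then have sep: "ennreal (2 * op_norm ?X) \<le> ?err (A, B) D + ?err ?S2 D" for D
        using op_norm_diff_triangle[of "policy_gradient Q R W (A, B) Kstar" "policy_gradient Q R W ?S2 Kstar" "g D"]
        by (simp add: op_norm_nonneg ennreal_leI flip: ennreal_plus)
      have "ennreal (2 * op_norm ?X * (1 - sqrt (\<kappa> / 2))) \<le> (\<integral>\<^sup>+ D. ?err (A, B) D \<partial>?P1) + (\<integral>\<^sup>+ D. ?err ?S2 D \<partial>?P2)"
        unfolding \<kappa>_def
        by (rule two_point_lower_bound[OF prob prob _ _ _ err err sep]) (use True op_norm_nonneg in auto)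
      also have "\<dots> = ?L (A, B) + ?L ?S2" using stab pert(1) by (simp add: estimation_loss_def)
      also have "\<dots> \<le> ?sup + ?sup"
        using assms(5) d1 S2 d2 by (intro add_mono SUP_upper) auto
      also have "\<dots> = 2 * ?sup" by (simp add: mult_2)
      also have "ennreal (2 * op_norm ?X * (1 - sqrt (\<kappa> / 2))) = 2 * ennreal (op_norm ?X * (1 - sqrt (\<kappa> / 2)))"
        using ennreal_mult'[of 2 "op_norm ?X * (1 - sqrt (\<kappa> / 2))"] by (simp add: mult.assoc)
      finally show "ennreal (op_norm ?X * (1 - sqrt (\<kappa> / 2))) \<le> ?sup"
        by (simp add: ennreal_mult_le_mult_iff)
    qed
    then have "enn2ereal (ennreal (op_norm ?X * (1 - sqrt (\<kappa> / 2)))) \<le> enn2ereal ?M"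
      by (simp add: less_eq_ennreal.rep_eq)
    \<comment> \<open>Only an inequality: \<open>ennreal\<close> sends a negative bound, which
      occurs when \<open>\<kappa> > 2\<close>, to 0.\<close>
    moreover have "ereal (op_norm ?X * (1 - sqrt (\<kappa> / 2))) \<le> enn2ereal (ennreal (op_norm ?X * (1 - sqrt (\<kappa> / 2))))"
      by (simp add: e2ennreal_def ennreal.rep_eq)
    ultimately show ?thesis unfolding kl by (rule order_trans[rotated])
  qed
qed

end
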